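(* Assume the following. (a) For every $i$: with probability $1$, $M_i(t_2,X_i)-M_i(t_1,X_i)=\int_{t_1}^{t_2}M_i'(t,X_i)\,dt$ for all intervals $(t_1,t_2)\subset\Theta$ (with endpoints in $\Theta$); moreover $\mathbf{E}M_i(\theta,X_i)=0$, $\mathbf{E}M_i^2(\theta,X_i)<\infty$, $\mathbf{E}|M_i'(\theta,X_i)|<\infty$. (b) For all sufficiently large $n$, $I_n>0$ and $J_n\neq 0$; moreover $|J_n|/\sqrt{I_n}\to\infty$, $\sum_{i=1}^n M_i'(\theta,X_i)/J_n\xrightarrow{p}1$ and $\sum_{i=1}^n M_i(\theta,X_i)/\sqrt{I_n}\Rightarrow\mathcal{N}(0,1)$. (c) $\lim_{\delta\to0}\limsup_{n\to\infty}\overline\tau_n(\delta)=0$. (d) The estimator $\theta_n^*=\theta_n^*(X_1,\dots,X_n)$ satisfies $\frac{|J_n|}{\sqrt{I_n}}|\theta_n^*-\theta|\,\overline\tau_n(|\theta_n^*-\theta|)\xrightarrow{p}0$. (e) $\sum_{i=1}^n[M_i'(\theta,X_i)]^2/J_n^2\xrightarrow{p}0$ and $\sum_{i=1}^nM_i^2(\theta,X_i)/I_n\xrightarrow{p}1$. Let $\theta_{n,M}^{**}=\theta_n^*-\sum_{i=1}^n M_i(\theta_n^*,X_i)\big/\sum_{i=1}^n M_i'(\theta_n^*,X_i)$. Then the statistic $$d_{n,M}^*=\sum_{i=1}^nM_i'(\theta_n^*,X_i)\Big/\Big(\sum_{i=1}^nM_i^2(\theta_{n,M}^{**},X_i)\Big)^{1/2}$$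 is defined with probability tending to $1$ and $$d_{n,M}^*\big(\theta_{n,M}^{**}-\theta\big)\Rightarrow\mathcal{N}(0,1).$$
   Context: All limits are as $n\to\infty$ unless stated otherwise; $\xrightarrow{p}$ is convergence in probability, $\Rightarrow$ is weak convergence of distributions. Setting: for each $n$ one observes independent elements $X_1,\dots,X_n$ of an arbitrary measurable space, not necessarily identically distributed. Their distributions depend on an unknown parameter belonging to an open set $\Theta\subset\mathbb{R}$, may also depend on $n$, and may depend on nuisance parameters. The symbol $\theta\in\Theta$ denotes the (fixed) true value, and $\mathbf{P},\mathbf{E}$ refer to the true distributions. For each $i$ there are given functions $M_i(t,X_i)$ and $M_i'(t,X_i)$ of $t\in\Theta$ (possibly depending on $n$). Notation: $I_n=\sum_{i=1}^n\mathbf{E}M_i^2(\theta,X_i)$, $J_n=\sum_{i=1}^n\mathbf{E}M_i'(\theta,X_i)$, $\overline\tau_n(\delta)=|J_n|^{-1}\sum_{i=1}^n\mathbf{E}\tau_i(\delta,X_i)$, where $\tau_i(\delta,X_i)=\sup_{t:|t-\theta|\le\delta}|M_i'(t,X_i)-M_i'(\theta,X_i)|$ if $[\theta-\delta,\theta+\delta]\subset\Theta$ and $\tau_i(\delta,X_i)=\infty$ otherwise. In $\overline\tau_n(|\theta_n^*-\theta|)$ the deterministic function $\overline\tau_n$ is evaluated at the random point $|\theta_n^*-\theta|$. A statistic is "defined with probability tending to $1$" if the probability that all quantities in its definition are defined (arguments in $\Theta$, denominators nonzero) tends to $1$. *)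

theory Defs
  imports "HOL-Probability.Probability"
begin

text \<open>
  Triangular-array conventions: for every sample size \<open>n\<close> there is a probability space \<open>P n\<close>
  carrying the observations \<open>X n 1, \<dots>, X n n\<close>.  \<open>M n i t x\<close> and \<open>M' n i t x\<close> stand for
  $M_i(t,x)$ and $M_i'(t,x)$ at sample size \<open>n\<close>; \<open>M'\<close> is an arbitrary given function,
  linked to \<open>M\<close> only through hypotheses.  Both are total in \<open>t\<close> for technical reasons: their
  values at \<open>t \<notin> \<Theta>\<close> are junk and must never be used.
\<close>

definition conv_in_prob ::
    "(nat \<Rightarrow> 'w measure) \<Rightarrow> (nat \<Rightarrow> 'w \<Rightarrow> real) \<Rightarrow> real \<Rightarrow> bool" where
  "conv_in_prob P Y c \<longleftrightarrow>
     (\<forall>\<epsilon>>0. (\<lambda>n. measure (P n) {\<omega> \<in> space (P n). \<bar>Y n \<omega> - c\<bar> > \<epsilon>}) \<longlonglongrightarrow> 0)"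

text \<open>Convergence in probability to zero of variables that may take the value \<open>\<infinity>\<close>.\<close>

definition conv_in_prob_0 ::
    "(nat \<Rightarrow> 'w measure) \<Rightarrow> (nat \<Rightarrow> 'w \<Rightarrow> ennreal) \<Rightarrow> bool" where
  "conv_in_prob_0 P Y \<longleftrightarrow>
     (\<forall>\<epsilon>::real. \<epsilon> > 0 \<longrightarrow> (\<lambda>n. measure (P n) {\<omega> \<in> space (P n). Y n \<omega> > ennreal \<epsilon>}) \<longlonglongrightarrow> 0)"

definition sample_sum ::
    "(nat \<Rightarrow> nat \<Rightarrow> real \<Rightarrow> 'a \<Rightarrow> real) \<Rightarrow> (nat \<Rightarrow> nat \<Rightarrow> 'w \<Rightarrow> 'a) \<Rightarrow> nat \<Rightarrow> real \<Rightarrow> 'w \<Rightarrow> real" where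
  "sample_sum M X n t \<omega> = (\<Sum>i=1..n. M n i t (X n i \<omega>))"

definition sample_sum_sq ::
    "(nat \<Rightarrow> nat \<Rightarrow> real \<Rightarrow> 'a \<Rightarrow> real) \<Rightarrow> (nat \<Rightarrow> nat \<Rightarrow> 'w \<Rightarrow> 'a) \<Rightarrow> nat \<Rightarrow> real \<Rightarrow> 'w \<Rightarrow> real" where
  "sample_sum_sq M X n t \<omega> = (\<Sum>i=1..n. (M n i t (X n i \<omega>))\<^sup>2)"

definition I_n ::
    "(nat \<Rightarrow> 'w measure) \<Rightarrow> (nat \<Rightarrow> nat \<Rightarrow> 'w \<Rightarrow> 'a) \<Rightarrow> (nat \<Rightarrow> nat \<Rightarrow> real \<Rightarrow> 'a \<Rightarrow> real)
     \<Rightarrow> real \<Rightarrow> nat \<Rightarrow> real" where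
  "I_n P X M \<theta> n = (\<Sum>i=1..n. \<integral>\<omega>. (M n i \<theta> (X n i \<omega>))\<^sup>2 \<partial>P n)"

definition J_n ::
    "(nat \<Rightarrow> 'w measure) \<Rightarrow> (nat \<Rightarrow> nat \<Rightarrow> 'w \<Rightarrow> 'a) \<Rightarrow> (nat \<Rightarrow> nat \<Rightarrow> real \<Rightarrow> 'a \<Rightarrow> real)
     \<Rightarrow> real \<Rightarrow> nat \<Rightarrow> real" where
  "J_n P X M' \<theta> n = (\<Sum>i=1..n. \<integral>\<omega>. M' n i \<theta> (X n i \<omega>) \<partial>P n)"

definition tau ::
    "real set \<Rightarrow> (nat \<Rightarrow> nat \<Rightarrow> real \<Rightarrow> 'a \<Rightarrow> real) \<Rightarrow> real \<Rightarrow> nat \<Rightarrow> nat \<Rightarrow> real \<Rightarrow> 'a \<Rightarrow> ennreal" where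
  "tau \<Theta> M' \<theta> n i \<delta> x =
     (if {\<theta> - \<delta>..\<theta> + \<delta>} \<subseteq> \<Theta>
      then SUP t\<in>{t. \<bar>t - \<theta>\<bar> \<le> \<delta>}. ennreal \<bar>M' n i t x - M' n i \<theta> x\<bar>
      else \<infinity>)"

definition tau_bar ::
    "(nat \<Rightarrow> 'w measure) \<Rightarrow> (nat \<Rightarrow> nat \<Rightarrow> 'w \<Rightarrow> 'a) \<Rightarrow> real set
     \<Rightarrow> (nat \<Rightarrow> nat \<Rightarrow> real \<Rightarrow> 'a \<Rightarrow> real) \<Rightarrow> real \<Rightarrow> nat \<Rightarrow> real \<Rightarrow> ennreal" where
  "tau_bar P X \<Theta> M' \<theta> n \<delta> =
     ennreal (1 / \<bar>J_n P X M' \<theta> n\<bar>) * (\<Sum>i=1..n. \<integral>\<^sup>+\<omega>. tau \<Theta> M' \<theta> n i \<delta> (X n i \<omega>) \<partial>P n)"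

text \<open>An estimator is a function of the tuple of the first \<open>n\<close> observations.\<close>

definition estimate ::
    "(nat \<Rightarrow> (nat \<Rightarrow> 'a) \<Rightarrow> real) \<Rightarrow> (nat \<Rightarrow> nat \<Rightarrow> 'w \<Rightarrow> 'a) \<Rightarrow> nat \<Rightarrow> 'w \<Rightarrow> real" where
  "estimate est X n \<omega> = est n (\<lambda>i\<in>{1..n}. X n i \<omega>)"

definition one_step ::
    "(nat \<Rightarrow> nat \<Rightarrow> real \<Rightarrow> 'a \<Rightarrow> real) \<Rightarrow> (nat \<Rightarrow> nat \<Rightarrow> real \<Rightarrow> 'a \<Rightarrow> real)
     \<Rightarrow> (nat \<Rightarrow> nat \<Rightarrow> 'w \<Rightarrow> 'a) \<Rightarrow> (nat \<Rightarrow> (nat \<Rightarrow> 'a) \<Rightarrow> real) \<Rightarrow> nat \<Rightarrow> 'w \<Rightarrow> real" where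
  "one_step M M' X est n \<omega> =
     estimate est X n \<omega>
     - sample_sum M X n (estimate est X n \<omega>) \<omega> / sample_sum M' X n (estimate est X n \<omega>) \<omega>"

definition d_stat ::
    "(nat \<Rightarrow> nat \<Rightarrow> real \<Rightarrow> 'a \<Rightarrow> real) \<Rightarrow> (nat \<Rightarrow> nat \<Rightarrow> real \<Rightarrow> 'a \<Rightarrow> real)
     \<Rightarrow> (nat \<Rightarrow> nat \<Rightarrow> 'w \<Rightarrow> 'a) \<Rightarrow> (nat \<Rightarrow> (nat \<Rightarrow> 'a) \<Rightarrow> real) \<Rightarrow> nat \<Rightarrow> 'w \<Rightarrow> real" where
  "d_stat M M' X est n \<omega> =
     sample_sum M' X n (estimate est X n \<omega>) \<omega>
     / sqrt (sample_sum_sq M X n (one_step M M' X est n \<omega>) \<omega>)"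

definition d_defined ::
    "real set \<Rightarrow> (nat \<Rightarrow> nat \<Rightarrow> real \<Rightarrow> 'a \<Rightarrow> real) \<Rightarrow> (nat \<Rightarrow> nat \<Rightarrow> real \<Rightarrow> 'a \<Rightarrow> real)
     \<Rightarrow> (nat \<Rightarrow> nat \<Rightarrow> 'w \<Rightarrow> 'a) \<Rightarrow> (nat \<Rightarrow> (nat \<Rightarrow> 'a) \<Rightarrow> real) \<Rightarrow> nat \<Rightarrow> 'w \<Rightarrow> bool" where
  "d_defined \<Theta> M M' X est n \<omega> \<longleftrightarrow>
     estimate est X n \<omega> \<in> \<Theta>
     \<and> sample_sum M' X n (estimate est X n \<omega>) \<omega> \<noteq> 0
     \<and> one_step M M' X est n \<omega> \<in> \<Theta>
     \<and> sample_sum_sq M X n (one_step M M' X est n \<omega>) \<omega> \<noteq> 0"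

text \<open>
  A random variable needs a value everywhere; where the statistic is undefined we use \<open>0\<close>.  Once
  the probability of being defined tends to 1, this choice does not affect the weak limit.
\<close>

definition studentized_error ::
    "real set \<Rightarrow> (nat \<Rightarrow> nat \<Rightarrow> real \<Rightarrow> 'a \<Rightarrow> real) \<Rightarrow> (nat \<Rightarrow> nat \<Rightarrow> real \<Rightarrow> 'a \<Rightarrow> real)
     \<Rightarrow> (nat \<Rightarrow> nat \<Rightarrow> 'w \<Rightarrow> 'a) \<Rightarrow> (nat \<Rightarrow> (nat \<Rightarrow> 'a) \<Rightarrow> real) \<Rightarrow> real \<Rightarrow> nat \<Rightarrow> 'w \<Rightarrow> real" where
  "studentized_error \<Theta> M M' X est \<theta> n \<omega> =
     (if d_defined \<Theta> M M' X est n \<omega>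
      then d_stat M M' X est n \<omega> * (one_step M M' X est n \<omega> - \<theta>)
      else 0)"

end

theory Submission
  imports Defs
begin

text \<open>
  With $R = \sum_i M_i(\theta_n^*) - \sum_i M_i(\theta) - (\theta_n^*-\theta)\sum_i M_i'(\theta_n^*)$
  the definition of the one-step estimator gives
  $\sum_i M_i'(\theta_n^*)\,(\theta_n^{**}-\theta) = -(\sum_i M_i(\theta) + R)$, and $|R|$ is at most
  $2|\theta_n^*-\theta|\sum_i\tau_i(|\theta_n^*-\theta|)$.  Hence $\theta_n^{**}-\theta$ is of order
  $\sqrt{I_n}/|J_n|$, so that $\sum_i M_i^2(\theta_n^{**})/I_n$ is close to
  $\sum_i M_i^2(\theta)/I_n$ by the triangle inequality in $\ell^2$, and the studentized error is
  $-\sum_i M_i(\theta)/\sqrt{I_n}$ up to a vanishing term; the normal law is symmetric.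

  The difficulty is that $\overline\tau_n$ only controls expectations at deterministic radii, while
  $|\theta_n^*-\theta|$ is random, depends on the sample and need not tend to \<open>0\<close>.  It is dominated,
  off an event of small probability, by a deterministic radius at which
  $|J_n| I_n^{-1/2}\delta\,\overline\tau_n(\delta)$ is still small, and there Markov's inequality applies.
\<close>

subsection \<open>Events of high probability\<close>

text \<open>Measurability is asked of the exceptional set \<open>B\<close> and not of
  \<open>Q n\<close>, so almost sure statements and existential ones over radii fit without being
  shown measurable. The level \<open>\<eta>\<close> is explicit because the levels of finitely many
  events are added up.\<close>

definition whp :: "(nat \<Rightarrow> 'w measure) \<Rightarrow> real \<Rightarrow> (nat \<Rightarrow> 'w \<Rightarrow> bool) \<Rightarrow> bool" where
  "whp P \<eta> Q \<longleftrightarrow> (\<forall>\<^sub>F n in sequentially.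
     \<exists>B\<in>sets (P n). measure (P n) B \<le> \<eta> \<and> (\<forall>\<omega>\<in>space (P n) - B. Q n \<omega>))"

lemma whp_mono:
  assumes "whp P \<eta> Q" "\<forall>\<^sub>F n in sequentially. \<forall>\<omega>\<in>space (P n). Q n \<omega> \<longrightarrow> R n \<omega>"
  shows "whp P \<eta> R"
  using assms unfolding whp_def
  by eventually_elim blast

lemma whp_conj:
  assumes "whp P \<alpha> Q" "whp P \<beta> R" "\<And>n. prob_space (P n)"
  shows "whp P (\<alpha> + \<beta>) (\<lambda>n \<omega>. Q n \<omega> \<and> R n \<omega>)"
  using assms(1,2) unfolding whp_def
proof eventually_elim
  case (elim n)
  interpret prob_space "P n" by (rule assms)
  obtain B C where B: "B \<in> sets (P n)" "measure (P n) B \<le> \<alpha>" "\<forall>\<omega>\<in>space (P n) - B. Q n \<omega>"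
    and C: "C \<in> sets (P n)" "measure (P n) C \<le> \<beta>" "\<forall>\<omega>\<in>space (P n) - C. R n \<omega>"
    using elim by blast
  have "measure (P n) (B \<union> C) \<le> \<alpha> + \<beta>"
    using measure_Un_le[OF B(1) C(1)] B(2) C(2) by linarith
  then show ?case using B C by (intro bexI[of _ "B \<union> C"]) auto
qed

lemma whp_AE:
  assumes "\<forall>\<^sub>F n in sequentially. AE \<omega> in P n. Q n \<omega>" "\<eta> \<ge> 0"
  shows "whp P \<eta> Q"
  using assms(1) unfolding whp_def
proof eventually_elim
  case (elim n)
  then obtain N where "{\<omega> \<in> space (P n). \<not> Q n \<omega>} \<subseteq> N" "emeasure (P n) N = 0" "N \<in> sets (P n)"
    by (rule AE_E)
  then show ?case using \<open>\<eta> \<ge> 0\<close> by (intro bexI[of _ N]) (auto simp: measure_def)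
qed

lemma whp_conv_in_prob:
  assumes conv: "conv_in_prob P Y c" and meas: "\<And>n. Y n \<in> borel_measurable (P n)"
    and "\<epsilon> > 0" "\<eta> > 0"
  shows "whp P \<eta> (\<lambda>n \<omega>. \<bar>Y n \<omega> - c\<bar> \<le> \<epsilon>)"
proof -
  have "(\<lambda>n. measure (P n) {\<omega> \<in> space (P n). \<bar>Y n \<omega> - c\<bar> > \<epsilon>}) \<longlonglongrightarrow> 0"
    using conv \<open>\<epsilon> > 0\<close> by (auto simp: conv_in_prob_def)
  from order_tendstoD(2)[OF this \<open>\<eta> > 0\<close>] show ?thesis
    unfolding whp_def
  proof eventually_elim
    case (elim n)
    have "{\<omega> \<in> space (P n). \<bar>Y n \<omega> - c\<bar> > \<epsilon>} \<in> sets (P n)"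
      using meas[of n] by measurable
    with elim show ?case by (intro bexI[of _ "{\<omega> \<in> space (P n). \<bar>Y n \<omega> - c\<bar> > \<epsilon>}"]) auto
  qed
qed

lemma whp_tendsto_1:
  assumes "\<And>n. prob_space (P n)" "\<And>n. {\<omega> \<in> space (P n). Q n \<omega>} \<in> sets (P n)"
    and whp: "\<And>\<eta>. \<eta> > 0 \<Longrightarrow> whp P \<eta> Q"
  shows "(\<lambda>n. measure (P n) {\<omega> \<in> space (P n). Q n \<omega>}) \<longlonglongrightarrow> 1"
proof (rule order_tendstoI)
  fix a :: real assume "a < 1"
  then have "whp P ((1 - a) / 2) Q" using whp by simp
  then show "\<forall>\<^sub>F n in sequentially. a < measure (P n) {\<omega> \<in> space (P n). Q n \<omega>}"
    unfolding whp_def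
  proof eventually_elim
    case (elim n)
    interpret prob_space "P n" by (rule assms)
    from elim obtain B where B: "B \<in> sets (P n)" "prob B \<le> (1 - a) / 2" "\<forall>\<omega>\<in>space (P n) - B. Q n \<omega>"
      by blast
    have "1 - prob B = prob (space (P n) - B)" using B(1) by (simp add: prob_compl)
    also have "\<dots> \<le> prob {\<omega> \<in> space (P n). Q n \<omega>}"
      using B assms(2) by (intro finite_measure_mono) auto
    finally show ?case using B(2) \<open>a < 1\<close> by (simp add: field_simps)
  qed
next
  fix a :: real assume "1 < a"
  then show "\<forall>\<^sub>F n in sequentially. measure (P n) {\<omega> \<in> space (P n). Q n \<omega>} < a"
    by (intro always_eventually allI) (meson assms(1) prob_space.prob_le_1 le_less_trans)
qed

subsection \<open>Weak convergence to the normal law\<close>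

text \<open>A law with a density has no atoms. Weak convergence to it is therefore convergence of
  distribution functions at every point.\<close>

lemma isCont_cdf_std_normal: "isCont (cdf std_normal_distribution) x"
proof -
  interpret real_distribution std_normal_distribution by (rule real_dist_normal_dist)
  have "emeasure std_normal_distribution {x} = 0"
    using AE_lborel_singleton[of x]
    by (subst emeasure_density) (auto simp: nn_integral_0_iff_AE indicator_def elim!: eventually_mono)
  then show ?thesis by (simp add: isCont_cdf measure_def)
qed

text \<open>The density is even, so the substitution with \<open>c = -1\<close> reflects the
  half-line; the endpoint gained or lost has mass zero.\<close>

lemma cdf_std_normal_minus: "cdf std_normal_distribution (- x) = 1 - cdf std_normal_distribution x"
proof -
  interpret real_distribution std_normal_distribution by (rule real_dist_normal_dist)
  have "emeasure std_normal_distribution {..- x}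
      = (\<integral>\<^sup>+y. ennreal (std_normal_density y) * indicator {..- x} y \<partial>lborel)"
    by (subst emeasure_density) auto
  also have "\<dots> = (\<integral>\<^sup>+y. ennreal (std_normal_density y) * indicator {x..} y \<partial>lborel)"
    by (subst nn_integral_real_affine[where c = "-1" and t = 0])
       (auto simp: normal_density_def indicator_def intro!: nn_integral_cong)
  also have "\<dots> = emeasure std_normal_distribution {x..}"
    by (subst emeasure_density) auto
  finally have "measure std_normal_distribution {..- x} = measure std_normal_distribution {x..}"
    by (simp add: measure_def)
  also have "\<dots> = 1 - measure std_normal_distribution {..<x}"
    by (subst prob_compl[symmetric]) (auto intro!: arg_cong[where f = "measure _"])
  also have "measure std_normal_distribution {..<x} = measure std_normal_distribution ({..<x} \<union> {x})"
    using isCont_cdf_std_normal[of x] isCont_cdf[of x] by (subst finite_measure_Union) auto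
  also have "{..<x} \<union> {x} = {..x}" by auto
  finally show ?thesis by (simp add: cdf_def)
qed

lemma cdf_distr:
  assumes "f \<in> borel_measurable N"
  shows "cdf (distr N borel f) x = measure N {\<omega> \<in> space N. f \<omega> \<le> x}"
  using assms by (auto simp: cdf_def measure_distr vimage_def Int_def conj_commute)

lemma weak_conv_std_normalD:
  assumes "weak_conv_m (\<lambda>n. distr (P n) borel (W n)) std_normal_distribution"
    and "\<And>n. W n \<in> borel_measurable (P n)"
  shows "(\<lambda>n. measure (P n) {\<omega> \<in> space (P n). W n \<omega> \<le> x}) \<longlonglongrightarrow> cdf std_normal_distribution x"
  using assms isCont_cdf_std_normal[of x]
  by (simp add: weak_conv_m_def weak_conv_def cdf_distr)

text \<open>Tightness: the tails beyond \<open>K\<close> approach those of the limit, and symmetry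
  controls both by one value of its distribution function. \<open>K \<ge> 1\<close> lets the
  expansion absorb small terms into powers of \<open>K\<close>.\<close>

lemma weak_conv_std_normal_tight:
  assumes W: "weak_conv_m (\<lambda>n. distr (P n) borel (W n)) std_normal_distribution"
    and meas: "\<And>n. W n \<in> borel_measurable (P n)"
    and prob: "\<And>n. prob_space (P n)" and "\<eta> > 0"
  obtains K where "K \<ge> 1" "whp P \<eta> (\<lambda>n \<omega>. \<bar>W n \<omega>\<bar> \<le> K)"
proof -
  interpret N: real_distribution std_normal_distribution by (rule real_dist_normal_dist)
  let ?F = "cdf std_normal_distribution"
  have "\<forall>\<^sub>F K in at_top. ?F K > 1 - \<eta> / 4"
    using order_tendstoD(1)[OF N.cdf_lim_at_top_prob, of "1 - \<eta> / 4"] \<open>\<eta> > 0\<close> by simp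
  from eventually_happens[OF eventually_conj[OF this eventually_ge_at_top[of 1]]]
  obtain K where K: "K \<ge> 1" "?F K > 1 - \<eta> / 4" by auto
  have "?F (-K) < \<eta> / 4" using K(2) by (simp add: cdf_std_normal_minus)
  then have "?F (-K) < \<eta> / 2" using \<open>\<eta> > 0\<close> by simp
  have "?F K > 1 - \<eta> / 2" using K(2) \<open>\<eta> > 0\<close> by simp
  note lim = weak_conv_std_normalD[OF W meas]
  have "whp P \<eta> (\<lambda>n \<omega>. \<bar>W n \<omega>\<bar> \<le> K)"
    unfolding whp_def
    using order_tendstoD(2)[OF lim[of "-K"] \<open>?F (-K) < \<eta> / 2\<close>]
      order_tendstoD(1)[OF lim[of K] \<open>?F K > 1 - \<eta> / 2\<close>]
  proof eventually_elim
    case (elim n)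
    interpret prob_space "P n" by (rule prob)
    note [measurable] = meas[of n]
    let ?L = "{\<omega> \<in> space (P n). W n \<omega> \<le> -K}" and ?U = "{\<omega> \<in> space (P n). W n \<omega> \<le> K}"
    have [measurable]: "?L \<in> events" "?U \<in> events" by measurable
    have "prob (?L \<union> (space (P n) - ?U)) \<le> prob ?L + prob (space (P n) - ?U)"
      by (intro measure_Un_le) auto
    also have "prob (space (P n) - ?U) = 1 - prob ?U" by (intro prob_compl) simp
    finally have "prob (?L \<union> (space (P n) - ?U)) \<le> \<eta>" using elim by linarith
    then show ?case by (intro bexI[of _ "?L \<union> (space (P n) - ?U)"]) auto
  qed
  then show thesis using K(1) that by blast
qed

text \<open>Slutsky's argument joined with the symmetry of the limit: \<open>Z n\<close> is close to
  \<open>- W n\<close>, so its distribution function is squeezed between probabilities of events on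
  \<open>W n\<close>.\<close>

lemma weak_conv_std_normal_reflect:
  assumes W: "weak_conv_m (\<lambda>n. distr (P n) borel (W n)) std_normal_distribution"
    and W_meas: "\<And>n. W n \<in> borel_measurable (P n)"
    and Z_meas: "\<And>n. Z n \<in> borel_measurable (P n)"
    and prob: "\<And>n. prob_space (P n)"
    and close: "\<And>\<eta>. \<eta> > 0 \<Longrightarrow> whp P \<eta> (\<lambda>n \<omega>. \<bar>Z n \<omega> + W n \<omega>\<bar> \<le> \<eta>)"
  shows "weak_conv_m (\<lambda>n. distr (P n) borel (Z n)) std_normal_distribution"
proof -
  let ?F = "cdf std_normal_distribution"
  note lim = weak_conv_std_normalD[OF W W_meas]
  have "(\<lambda>n. measure (P n) {\<omega> \<in> space (P n). Z n \<omega> \<le> x}) \<longlonglongrightarrow> ?F x" for x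
  proof (rule tendstoI)
    fix e :: real assume "e > 0"
    then have "e / 4 > 0" by simp
    have "(?F \<longlongrightarrow> ?F x) (at x)" using isCont_cdf_std_normal by (simp add: isCont_def)
    from LIM_D[OF this \<open>e / 4 > 0\<close>] obtain s where s: "s > 0"
      "\<And>y. y \<noteq> x \<Longrightarrow> \<bar>y - x\<bar> < s \<Longrightarrow> \<bar>?F y - ?F x\<bar> < e / 4" by auto
    \<comment> \<open>\<open>\<eta>\<close> bounds both the distance from \<open>Z n\<close> to
      \<open>- W n\<close> and the exceptional probability; \<open>2 * \<eta> < s\<close> keeps the
      shifted points where continuity controls \<open>?F\<close>.\<close>
    define \<eta> where "\<eta> = min (s / 3) (e / 4)"
    have \<eta>: "\<eta> > 0" "2 * \<eta> < s" "\<eta> \<le> e / 4" using s(1) \<open>e > 0\<close> by (auto simp: \<eta>_def)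
    have "\<bar>?F (x + 2 * \<eta>) - ?F x\<bar> < e / 4" "\<bar>?F (x - \<eta>) - ?F x\<bar> < e / 4"
      using s(2)[of "x + 2 * \<eta>"] s(2)[of "x - \<eta>"] \<eta> by auto
    then have up: "?F (x + 2 * \<eta>) < ?F x + e / 4" and lo: "?F (x - \<eta>) > ?F x - e / 4"
      by linarith+
    have 1: "?F (- x - 2 * \<eta>) = 1 - ?F (x + 2 * \<eta>)" "?F (- x + \<eta>) = 1 - ?F (x - \<eta>)"
      using cdf_std_normal_minus[of "x + 2 * \<eta>"] cdf_std_normal_minus[of "x - \<eta>"] by (auto simp: algebra_simps)
    have "?F (- x - 2 * \<eta>) > 1 - ?F x - e / 4" "?F (- x + \<eta>) < 1 - ?F x + e / 4"
      using up lo 1 by auto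
    then have ev: "\<forall>\<^sub>F n in sequentially. 1 - ?F x - e / 4 < measure (P n) {\<omega> \<in> space (P n). W n \<omega> \<le> - x - 2 * \<eta>}"
      "\<forall>\<^sub>F n in sequentially. measure (P n) {\<omega> \<in> space (P n). W n \<omega> \<le> - x + \<eta>} < 1 - ?F x + e / 4"
      using order_tendstoD[OF lim] by blast+
    show "\<forall>\<^sub>F n in sequentially. dist (measure (P n) {\<omega> \<in> space (P n). Z n \<omega> \<le> x}) (?F x) < e"
      using close[OF \<eta>(1)] ev unfolding whp_def
    proof eventually_elim
      case (elim n)
      interpret prob_space "P n" by (rule prob)
      note [measurable] = W_meas[of n] Z_meas[of n]
      obtain B where B: "B \<in> events" "prob B \<le> \<eta>" "\<forall>\<omega>\<in>space (P n) - B. \<bar>Z n \<omega> + W n \<omega>\<bar> \<le> \<eta>"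
        using elim(1) by blast
      let ?Z = "{\<omega> \<in> space (P n). Z n \<omega> \<le> x}"
      let ?A = "{\<omega> \<in> space (P n). W n \<omega> \<le> - x - 2 * \<eta>}"
      let ?C = "{\<omega> \<in> space (P n). W n \<omega> \<le> - x + \<eta>}"
      have m: "?Z \<in> events" "?A \<in> events" "?C \<in> events" by measurable
      \<comment> \<open>Outside \<open>B\<close>, \<open>Z n \<omega> \<le> x\<close> gives
        \<open>W n \<omega> \<ge> - x - \<eta>\<close>; the shift by \<open>2 * \<eta>\<close> makes
        this strict, as leaving \<open>?A\<close> requires.\<close>
      have "?Z \<subseteq> (space (P n) - ?A) \<union> B"
      proof
        fix \<omega> assume \<omega>: "\<omega> \<in> ?Z"
        show "\<omega> \<in> (space (P n) - ?A) \<union> B"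
        proof (cases "\<omega> \<in> B")
          case False
          then have "\<bar>Z n \<omega> + W n \<omega>\<bar> \<le> \<eta>" using B(3) \<omega> by auto
          then show ?thesis using \<omega> \<eta>(1) by auto
        qed simp
      qed
      then have "prob ?Z \<le> prob ((space (P n) - ?A) \<union> B)"
        using m B(1) by (intro finite_measure_mono) auto
      also have "\<dots> \<le> prob (space (P n) - ?A) + prob B"
        using m B(1) by (intro measure_Un_le) auto
      also have "prob (space (P n) - ?A) = 1 - prob ?A" using m by (intro prob_compl)
      finally have le: "prob ?Z \<le> 1 - prob ?A + prob B" .
      have "space (P n) - ?C \<subseteq> ?Z \<union> B"
      proof
        fix \<omega> assume \<omega>: "\<omega> \<in> space (P n) - ?C"
        show "\<omega> \<in> ?Z \<union> B"
        proof (cases "\<omega> \<in> B")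
          case False
          then have "\<bar>Z n \<omega> + W n \<omega>\<bar> \<le> \<eta>" using B(3) \<omega> by auto
          then show ?thesis using \<omega> by auto
        qed simp
      qed
      then have "prob (space (P n) - ?C) \<le> prob (?Z \<union> B)"
        using m B(1) by (intro finite_measure_mono) auto
      also have "\<dots> \<le> prob ?Z + prob B"
        using m B(1) by (intro measure_Un_le) auto
      also have "prob (space (P n) - ?C) = 1 - prob ?C" using m by (intro prob_compl)
      finally have ge: "1 - prob ?C \<le> prob ?Z + prob B" .
      show ?case
        using le ge elim(2,3) B(2) \<eta>(3) \<open>e > 0\<close> unfolding dist_real_def abs_less_iff by linarith
    qed
  qed
  then show ?thesis by (simp add: weak_conv_m_def weak_conv_def cdf_distr[OF Z_meas])
qed

subsection \<open>The one-step expansion off the bad event\<close>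

text \<open>The bounds \<open>c - B\<close> and \<open>c + B\<close> on \<open>f'\<close> are
  integrated over the segment between \<open>\<theta>\<close> and \<open>t\<close>. The free centre
  \<open>c\<close> serves two uses: the slope at \<open>t\<close> for the Newton remainder, and
  \<open>0\<close> for a Lipschitz bound.\<close>

lemma increment_bound:
  fixes f f' :: "real \<Rightarrow> real"
  assumes FTC: "\<forall>t1 t2. t1 < t2 \<and> {t1..t2} \<subseteq> \<Theta> \<longrightarrow> set_integrable lborel {t1..t2} f' \<and>
      f t2 - f t1 = (LINT t:{t1..t2}|lborel. f' t)"
    and sub: "{\<theta> - d..\<theta> + d} \<subseteq> \<Theta>" and t: "\<bar>t - \<theta>\<bar> \<le> d"
    and B: "\<And>s. \<bar>s - \<theta>\<bar> \<le> d \<Longrightarrow> \<bar>f' s - c\<bar> \<le> B"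
  shows "\<bar>f t - f \<theta> - (t - \<theta>) * c\<bar> \<le> \<bar>t - \<theta>\<bar> * B"
proof -
  have *: "\<bar>f b - f a - (b - a) * c\<bar> \<le> (b - a) * B"
    if "a < b" "{a..b} \<subseteq> {\<theta> - d..\<theta> + d}" for a b
  proof -
    have int: "set_integrable lborel {a..b} f'" and eq: "f b - f a = (LINT t:{a..b}|lborel. f' t)"
      using FTC that sub by (meson order_trans)+
    have const: "(LINT t:{a..b}|lborel. k) = (b - a) * k" "set_integrable lborel {a..b} (\<lambda>t. k)" for k :: real
      using \<open>a < b\<close> by (auto simp: set_lebesgue_integral_def set_integrable_def)
    have b: "\<bar>f' s - c\<bar> \<le> B" if "s \<in> {a..b}" for s
      using B[of s] that \<open>{a..b} \<subseteq> _\<close> by (auto simp: abs_le_iff)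
    have "(LINT t:{a..b}|lborel. c - B) \<le> (LINT t:{a..b}|lborel. f' t)"
      using b int const by (intro set_integral_mono) (force simp: abs_le_iff)+
    moreover have "(LINT t:{a..b}|lborel. f' t) \<le> (LINT t:{a..b}|lborel. c + B)"
      using b int const by (intro set_integral_mono) (force simp: abs_le_iff)+
    ultimately show ?thesis using eq by (simp add: const abs_le_iff algebra_simps)
  qed
  consider "t = \<theta>" | "t < \<theta>" | "t > \<theta>" by linarith
  then show ?thesis
  proof cases
    case 2
    then show ?thesis using *[of t \<theta>] t by (auto simp: abs_if algebra_simps split: if_splits)
  next
    case 3
    then show ?thesis using *[of \<theta> t] t by (auto simp: abs_if algebra_simps split: if_splits)
  qed simp
qed

text \<open>The deterministic core at one outcome, with every probabilistic input turned into a
  numerical bound. The radius \<open>d\<close> dominates the error of the initial point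
  \<open>t\<close> and may be large, so its product with the sum of \<open>b\<close> must be small
  too; \<open>\<delta>\<close> is a radius within which the updated point \<open>u\<close> is shown
  to lie.\<close>

lemma one_step_expansion:
  fixes m m' :: "'i \<Rightarrow> real \<Rightarrow> real" and b c :: "'i \<Rightarrow> real"
  assumes FTC: "\<And>i. i \<in> A \<Longrightarrow> \<forall>t1 t2. t1 < t2 \<and> {t1..t2} \<subseteq> \<Theta> \<longrightarrow>
      set_integrable lborel {t1..t2} (m' i) \<and> m i t2 - m i t1 = (LINT t:{t1..t2}|lborel. m' i t)"
    and J: "J \<noteq> 0" and I: "I > 0" and e: "e > 0" "K \<ge> 1" "40 * K * e \<le> 1"
    and d: "{\<theta> - d..\<theta> + d} \<subseteq> \<Theta>" "\<bar>t - \<theta>\<bar> \<le> d"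
    and b: "\<And>i s. i \<in> A \<Longrightarrow> \<bar>s - \<theta>\<bar> \<le> d \<Longrightarrow> \<bar>m' i s - m' i \<theta>\<bar> \<le> b i"
      "(\<Sum>i\<in>A. b i) \<le> e\<^sup>2 * \<bar>J\<bar>" "d * (\<Sum>i\<in>A. b i) \<le> e\<^sup>2 * sqrt I"
    and \<delta>: "{\<theta> - \<delta>..\<theta> + \<delta>} \<subseteq> \<Theta>" "\<delta> > 0" "4 * K * sqrt I \<le> \<delta> * \<bar>J\<bar>"
    and c: "\<And>i s. i \<in> A \<Longrightarrow> \<bar>s - \<theta>\<bar> \<le> \<delta> \<Longrightarrow> \<bar>m' i s - m' i \<theta>\<bar> \<le> c i"
      "(\<Sum>i\<in>A. c i) \<le> e\<^sup>2 * \<bar>J\<bar>"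
    and m'_sum: "\<bar>(\<Sum>i\<in>A. m' i \<theta>) / J - 1\<bar> \<le> e\<^sup>2"
    and m'_sq: "(\<Sum>i\<in>A. (m' i \<theta>)\<^sup>2) / J\<^sup>2 \<le> e\<^sup>2"
    and m_sum: "\<bar>(\<Sum>i\<in>A. m i \<theta>) / sqrt I\<bar> \<le> K"
    and m_sq: "\<bar>(\<Sum>i\<in>A. (m i \<theta>)\<^sup>2) / I - 1\<bar> \<le> e\<^sup>2"
  defines "s' \<equiv> \<Sum>i\<in>A. m' i t" and "u \<equiv> t - (\<Sum>i\<in>A. m i t) / (\<Sum>i\<in>A. m' i t)"
  shows "s' \<noteq> 0" "u \<in> \<Theta>" "(\<Sum>i\<in>A. (m i u)\<^sup>2) \<noteq> 0"
    "\<bar>s' / sqrt (\<Sum>i\<in>A. (m i u)\<^sup>2) * (u - \<theta>) + (\<Sum>i\<in>A. m i \<theta>) / sqrt I\<bar> \<le> 22 * K\<^sup>2 * e"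
proof -
  \<comment> \<open>Since \<open>K \<ge> 1\<close>, \<open>e\<close> is at most
    \<open>1 / 40\<close>, which makes terms in \<open>e\<^sup>2\<close> negligible against terms in
    \<open>e\<close>.\<close>
  have "40 * e \<le> 40 * K * e" using e by simp
  then have "e \<le> 1 / 40" using e by linarith
  have e2: "e\<^sup>2 \<le> e / 40" "e\<^sup>2 \<le> 1 / 1600"
    using mult_left_mono[OF \<open>e \<le> 1 / 40\<close>, of e] e(1) \<open>e \<le> 1 / 40\<close> unfolding power2_eq_square by linarith+
  have d0: "d \<ge> 0" using d(2) by linarith
  have b0: "b i \<ge> 0" and c0: "c i \<ge> 0" if "i \<in> A" for i
    using b(1)[OF that, of \<theta>] c(1)[OF that, of \<theta>] d0 \<delta>(2) by auto
  have sI: "sqrt I > 0" using I by simp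
  define W where "W = (\<Sum>i\<in>A. m i \<theta>) / sqrt I"

  \<comment> \<open>The slope \<open>s'\<close> differs from \<open>J\<close> by a relative error of
    at most \<open>2 * e\<^sup>2\<close>, well below one half, so the Newton step divides by a
    nonzero number.\<close>
  have "s' - (\<Sum>i\<in>A. m' i \<theta>) = (\<Sum>i\<in>A. m' i t - m' i \<theta>)"
    by (simp add: s'_def sum_subtractf)
  also have "\<bar>\<dots>\<bar> \<le> (\<Sum>i\<in>A. b i)"
    using b(1) d(2) by (intro order.trans[OF sum_abs] sum_mono)
  also have "\<dots> \<le> e\<^sup>2 * \<bar>J\<bar>" by (rule b)
  finally have "\<bar>(s' - (\<Sum>i\<in>A. m' i \<theta>)) / J\<bar> \<le> e\<^sup>2"
    using J by (simp add: abs_divide divide_le_eq)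
  then have "\<bar>s' / J - 1\<bar> \<le> 1 / 2"
    using m'_sum e2 unfolding diff_divide_distrib by linarith
  then have "\<bar>s' / J\<bar> \<ge> 1 / 2" by linarith
  then have s'_ge: "\<bar>s'\<bar> \<ge> \<bar>J\<bar> / 2" using J by (simp add: abs_divide le_divide_eq)
  then show s'0: "s' \<noteq> 0" using J by auto

  \<comment> \<open>The Newton remainder. The slope is taken at \<open>t\<close> whereas
    \<open>b\<close> measures increments from \<open>\<theta>\<close>; passing through
    \<open>\<theta>\<close> costs the factor 2.\<close>
  define \<rho> where "\<rho> = (\<Sum>i\<in>A. m i t) - (\<Sum>i\<in>A. m i \<theta>) - (t - \<theta>) * s'"
  have "\<rho> = (\<Sum>i\<in>A. m i t - m i \<theta> - (t - \<theta>) * m' i t)"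
    by (simp add: \<rho>_def s'_def sum_subtractf sum_distrib_left)
  also have "\<bar>\<dots>\<bar> \<le> (\<Sum>i\<in>A. d * (2 * b i))"
  proof (intro order.trans[OF sum_abs] sum_mono)
    fix i assume i: "i \<in> A"
    have "\<bar>m' i s - m' i t\<bar> \<le> 2 * b i" if "\<bar>s - \<theta>\<bar> \<le> d" for s
      using b(1)[OF i that] b(1)[OF i d(2)] by linarith
    from increment_bound[OF FTC[OF i] d this]
    have "\<bar>m i t - m i \<theta> - (t - \<theta>) * m' i t\<bar> \<le> \<bar>t - \<theta>\<bar> * (2 * b i)" .
    also have "\<dots> \<le> d * (2 * b i)" using d(2) b0[OF i] by (intro mult_right_mono) auto
    finally show "\<bar>m i t - m i \<theta> - (t - \<theta>) * m' i t\<bar> \<le> d * (2 * b i)" .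
  qed
  also have "\<dots> = 2 * (d * (\<Sum>i\<in>A. b i))" by (simp add: sum_distrib_left mult_ac)
  also have "\<dots> \<le> 2 * e\<^sup>2 * sqrt I" using b(3) by simp
  finally have \<rho>: "\<bar>\<rho> / sqrt I\<bar> \<le> 2 * e\<^sup>2" using sI by (simp add: abs_divide divide_le_eq)
  \<comment> \<open>Multiplying the definition of \<open>u\<close> by \<open>s'\<close> cancels the
    values at \<open>t\<close> and leaves minus the sum of the \<open>m i \<theta>\<close> and
    \<open>\<rho>\<close>.\<close>
  have su: "s' * (u - \<theta>) = - ((W + \<rho> / sqrt I) * sqrt I)"
    using s'0 sI by (simp add: u_def W_def \<rho>_def s'_def[symmetric] field_simps)
  \<comment> \<open>The factor 2 from the slope and the bound \<open>2 * K\<close> on the normalized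
    score give \<open>4 * K\<close>, the constant in the hypothesis on
    \<open>\<delta>\<close>.\<close>
  have "\<bar>J\<bar> / 2 * \<bar>u - \<theta>\<bar> \<le> \<bar>s'\<bar> * \<bar>u - \<theta>\<bar>"
    using s'_ge by (intro mult_right_mono) auto
  also have "\<dots> = \<bar>W + \<rho> / sqrt I\<bar> * sqrt I"
    using arg_cong[OF su, of abs] sI by (simp add: abs_mult)
  also have "\<dots> \<le> (2 * K) * sqrt I"
    using m_sum \<rho> e2 e(2) sI unfolding W_def[symmetric] by (intro mult_right_mono) linarith+
  finally have Ju: "\<bar>J\<bar> * \<bar>u - \<theta>\<bar> \<le> 4 * K * sqrt I" by simp
  also have "\<dots> \<le> \<bar>J\<bar> * \<delta>" using \<delta>(3) by (simp add: mult_ac)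
  finally have u\<delta>: "\<bar>u - \<theta>\<bar> \<le> \<delta>" using J by simp
  then show "u \<in> \<Theta>" using \<delta>(1) by (auto simp: abs_le_iff)

  \<comment> \<open>Within \<open>\<delta>\<close> each derivative is at most
    \<open>\<bar>m' i \<theta>\<bar> + c i\<close>. Minkowski's inequality separates the two parts:
    \<open>m'_sq\<close> handles the first, and the l2 norm of \<open>c\<close> is at most its l1
    norm.\<close>
  have "L2_set (\<lambda>i. m i u - m i \<theta>) A \<le> L2_set (\<lambda>i. \<bar>u - \<theta>\<bar> * (\<bar>m' i \<theta>\<bar> + c i)) A"
  proof -
    have "\<bar>m i u - m i \<theta>\<bar> \<le> \<bar>u - \<theta>\<bar> * (\<bar>m' i \<theta>\<bar> + c i)" if i: "i \<in> A" for i
    proof -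
      have "\<bar>m' i s - 0\<bar> \<le> \<bar>m' i \<theta>\<bar> + c i" if "\<bar>s - \<theta>\<bar> \<le> \<delta>" for s
        using c(1)[OF i that] by linarith
      from increment_bound[OF FTC[OF i] \<delta>(1) u\<delta> this] show ?thesis by simp
    qed
    then have "L2_set (\<lambda>i. \<bar>m i u - m i \<theta>\<bar>) A \<le> L2_set (\<lambda>i. \<bar>u - \<theta>\<bar> * (\<bar>m' i \<theta>\<bar> + c i)) A"
      by (intro L2_set_mono) auto
    then show ?thesis by (simp add: L2_set_def)
  qed
  also have "\<dots> = \<bar>u - \<theta>\<bar> * L2_set (\<lambda>i. \<bar>m' i \<theta>\<bar> + c i) A"
    by (simp add: L2_set_right_distrib)
  also have "\<dots> \<le> \<bar>u - \<theta>\<bar> * (2 * e * \<bar>J\<bar>)"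
  proof (intro mult_left_mono)
    have "L2_set (\<lambda>i. \<bar>m' i \<theta>\<bar> + c i) A \<le> L2_set (\<lambda>i. \<bar>m' i \<theta>\<bar>) A + L2_set c A"
      by (rule L2_set_triangle_ineq)
    also have "L2_set c A \<le> (\<Sum>i\<in>A. c i)" using c0 by (rule L2_set_le_sum)
    also have "\<dots> \<le> e * \<bar>J\<bar>"
      using c(2) mult_right_mono[of "e\<^sup>2" e "\<bar>J\<bar>"] e2 e(1) by linarith
    also have "L2_set (\<lambda>i. \<bar>m' i \<theta>\<bar>) A \<le> sqrt ((e * \<bar>J\<bar>)\<^sup>2)"
      unfolding L2_set_def using m'_sq J
      by (intro real_sqrt_le_mono) (simp add: divide_le_eq power_mult_distrib)
    also have "\<dots> = e * \<bar>J\<bar>" using e(1) by simp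
    finally show "L2_set (\<lambda>i. \<bar>m' i \<theta>\<bar> + c i) A \<le> 2 * e * \<bar>J\<bar>" by simp
  qed simp
  also have "\<dots> = 2 * e * (\<bar>J\<bar> * \<bar>u - \<theta>\<bar>)" by simp
  also have "\<dots> \<le> 2 * e * (4 * K * sqrt I)" using Ju e(1) by (intro mult_left_mono) auto
  finally have diff: "L2_set (\<lambda>i. m i u - m i \<theta>) A \<le> 8 * K * e * sqrt I"
    by (simp add: mult_ac)

  \<comment> \<open>Normalized l2 norms at \<open>u\<close> and at \<open>\<theta>\<close>: the
    triangle inequality in both directions brings \<open>v\<close> close to \<open>w\<close>, and
    \<open>m_sq\<close> brings \<open>w\<close> close to 1.\<close>
  define v where "v = L2_set (\<lambda>i. m i u) A / sqrt I"
  define w where "w = L2_set (\<lambda>i. m i \<theta>) A / sqrt I"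
  have "L2_set (\<lambda>i. m i u) A \<le> L2_set (\<lambda>i. m i \<theta>) A + L2_set (\<lambda>i. m i u - m i \<theta>) A"
    using L2_set_triangle_ineq[of "\<lambda>i. m i \<theta>" "\<lambda>i. m i u - m i \<theta>" A] by simp
  moreover have "L2_set (\<lambda>i. m i \<theta>) A \<le> L2_set (\<lambda>i. m i u) A + L2_set (\<lambda>i. m i u - m i \<theta>) A"
    using L2_set_triangle_ineq[of "\<lambda>i. m i u" "\<lambda>i. m i \<theta> - m i u" A]
    by (simp add: L2_set_def power2_commute)
  ultimately have "\<bar>L2_set (\<lambda>i. m i u) A - L2_set (\<lambda>i. m i \<theta>) A\<bar> \<le> 8 * K * e * sqrt I"
    using diff by linarith
  then have vw: "\<bar>v - w\<bar> \<le> 8 * K * e"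
    using sI by (simp add: v_def w_def diff_divide_distrib[symmetric] abs_divide divide_le_eq)
  have w0: "w \<ge> 0" using sI by (simp add: w_def)
  have "w\<^sup>2 = (\<Sum>i\<in>A. (m i \<theta>)\<^sup>2) / I"
    using I by (simp add: w_def L2_set_def power_divide sum_nonneg)
  \<comment> \<open>The left side equals \<open>\<bar>w\<^sup>2 - 1\<bar>\<close>; as
    \<open>w + 1 \<ge> 1\<close>, closeness to 1 passes from the square to \<open>w\<close> with the
    same bound.\<close>
  then have "\<bar>w - 1\<bar> * (w + 1) \<le> e\<^sup>2"
    using m_sq w0 by (metis abs_mult abs_of_nonneg add_nonneg_nonneg mult.commute power2_eq_square
        square_diff_one_factored zero_le_one)
  moreover have "\<bar>w - 1\<bar> \<le> \<bar>w - 1\<bar> * (w + 1)"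
    using w0 mult_left_mono[of 1 "w + 1" "\<bar>w - 1\<bar>"] by simp
  ultimately have "\<bar>w - 1\<bar> \<le> e\<^sup>2" by linarith
  moreover have "e\<^sup>2 \<le> K * e" using e2(1) e mult_right_mono[of 1 K e] by linarith
  ultimately have v1: "\<bar>v - 1\<bar> \<le> 9 * K * e" using vw by linarith
  then have v: "v \<ge> 1 / 2" using e(3) by linarith
  then show "(\<Sum>i\<in>A. (m i u)\<^sup>2) \<noteq> 0" by (auto simp: v_def L2_set_def)

  have "s' / sqrt (\<Sum>i\<in>A. (m i u)\<^sup>2) * (u - \<theta>) = s' * (u - \<theta>) / (v * sqrt I)"
    using sI by (simp add: v_def L2_set_def)
  also have "\<dots> = - (W + \<rho> / sqrt I) / v"
    unfolding su using sI v by (simp add: field_simps)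
  finally have "s' / sqrt (\<Sum>i\<in>A. (m i u)\<^sup>2) * (u - \<theta>) + W = (W * (v - 1) - \<rho> / sqrt I) / v"
    using v by (simp add: field_simps)
  also have "\<bar>\<dots>\<bar> = \<bar>W * (v - 1) - \<rho> / sqrt I\<bar> / v" using v by (simp add: abs_divide)
  also have "\<dots> \<le> (K * (9 * K * e) + 2 * e\<^sup>2) / v"
  proof (intro divide_right_mono)
    have "\<bar>W * (v - 1)\<bar> \<le> K * (9 * K * e)"
      unfolding abs_mult using m_sum v1 e by (intro mult_mono) (auto simp: W_def)
    then show "\<bar>W * (v - 1) - \<rho> / sqrt I\<bar> \<le> K * (9 * K * e) + 2 * e\<^sup>2" using \<rho> by linarith
  qed (use v in simp)
  \<comment> \<open>Dividing by at least \<open>1 / 2\<close> yields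
    \<open>18 * K\<^sup>2 * e + 4 * e\<^sup>2\<close>, and
    \<open>e\<^sup>2 \<le> K\<^sup>2 * e\<close> turns 18 and 4 into 22.\<close>
  also have "\<dots> \<le> (K * (9 * K * e) + 2 * e\<^sup>2) / (1 / 2)"
    using v e by (intro divide_left_mono) auto
  also have "\<dots> \<le> 22 * K\<^sup>2 * e"
  proof -
    have "e \<le> K\<^sup>2 * e" using e by simp
    then show ?thesis using e2(1) e(1) by (simp add: power2_eq_square)
  qed
  finally show "\<bar>s' / sqrt (\<Sum>i\<in>A. (m i u)\<^sup>2) * (u - \<theta>) + (\<Sum>i\<in>A. m i \<theta>) / sqrt I\<bar> \<le> 22 * K\<^sup>2 * e"
    by (simp add: W_def)
qed

subsection \<open>A deterministic radius for the estimator\<close>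

text \<open>The values of \<open>g\<close> lie in an arbitrary linear order; the indicator
  \<open>h\<close> of the complement is monotone and real-valued, hence Borel.\<close>

lemma sublevel_mono_borel:
  fixes g :: "real \<Rightarrow> 'b::linorder"
  assumes "mono g"
  shows "{y. g y \<le> z} \<in> sets borel"
proof -
  define h :: "real \<Rightarrow> real" where "h y = (if g y \<le> z then 0 else 1)" for y
  have "mono h"
    using monoD[OF assms] by (auto simp: h_def intro!: monoI) (meson order_trans)
  then have "h \<in> borel_measurable borel" by (rule borel_measurable_mono)
  then have "h -` {0} \<inter> space borel \<in> sets borel" by (rule measurable_sets) simp
  also have "h -` {0} \<inter> space borel = {y. g y \<le> z}" by (auto simp: h_def split: if_splits)
  finally show ?thesis .
qed

text \<open>
  As \<open>g\<close> need not be left-continuous, the sublevel set may fail to contain its supremum; this is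
  where the slack \<open>\<eta>\<close> is needed.
\<close>

lemma (in prob_space) approximate_quantile:
  fixes g :: "real \<Rightarrow> ennreal" and Y :: "'a \<Rightarrow> real"
  assumes [measurable]: "Y \<in> borel_measurable M" and g: "mono g" and 0: "g 0 \<le> z"
    and "\<eta> > 0"
  obtains d where "d \<ge> 0" "g d \<le> z"
    "prob {\<omega> \<in> space M. g (Y \<omega>) \<le> z \<and> d < Y \<omega>} \<le> \<eta>"
proof (cases "\<exists>d\<ge>0. g d \<le> z \<and> (\<forall>y. g y \<le> z \<longrightarrow> y \<le> d)")
  \<comment> \<open>A largest element of the sublevel set serves as \<open>d\<close>, and the
    exceedance event is empty.\<close>
  case True
  then obtain d where d: "d \<ge> 0" "g d \<le> z" "\<And>y. g y \<le> z \<Longrightarrow> y \<le> d" by blast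
  then have "{\<omega> \<in> space M. g (Y \<omega>) \<le> z \<and> d < Y \<omega>} = {}" by (auto simp: not_less)
  then show thesis using d that \<open>\<eta> > 0\<close> by (metis measure_empty less_imp_le)
next
  case False
  then have ex: "\<exists>y>d. g y \<le> z" if "d \<ge> 0" "g d \<le> z" for d using that by (meson not_le)
  \<comment> \<open>With no largest element, the nonnegative rationals of the sublevel set are
    cofinal in it, and their enumeration gives a sequence for continuity from above.\<close>
  let ?S = "{q :: rat. real_of_rat q \<ge> 0 \<and> g (real_of_rat q) \<le> z}"
  have "0 \<in> ?S" using 0 by simp
  then have "?S \<noteq> {}" by blast
  define r where "r k = real_of_rat (from_nat_into ?S k)" for k
  have r: "r k \<ge> 0" "g (r k) \<le> z" for k
    using from_nat_into[OF \<open>?S \<noteq> {}\<close>, of k] by (auto simp: r_def)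
  have cof: "\<exists>k. y < r k" if y: "g y \<le> z" for y
  proof -
    have "g (max y 0) \<le> z" using y 0 by (auto simp: max_def)
    then obtain y' where "y' > max y 0" "g y' \<le> z" using ex[of "max y 0"] by auto
    moreover obtain q where q: "max y 0 < real_of_rat q" "real_of_rat q < y'"
      using of_rat_dense \<open>y' > max y 0\<close> by blast
    moreover have "g (real_of_rat q) \<le> g y'" using monoD[OF g] q(2) by simp
    ultimately have "q \<in> ?S" by (auto simp: less_le)
    then obtain k where "from_nat_into ?S k = q"
      using from_nat_into_surj[of ?S q] by auto
    then show ?thesis using q(1) by (intro exI[of _ k]) (auto simp: r_def)
  qed
  \<comment> \<open>Running maxima remain in the sublevel set, being attained, and make the events
    \<open>?E k\<close> decrease; cofinality empties their intersection.\<close>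
  define d where "d k = Max (r ` {..k})" for k
  have dr: "d k \<in> r ` {..k}" "\<And>j. j \<le> k \<Longrightarrow> r j \<le> d k" for k
    unfolding d_def by (intro Max_in Max_ge; auto)+
  have d: "d k \<ge> 0" "g (d k) \<le> z" for k using dr(1)[of k] r by auto
  let ?A = "{y. g y \<le> z}"
  have [measurable]: "?A \<in> sets borel" by (rule sublevel_mono_borel[OF g])
  let ?E = "\<lambda>k. {\<omega> \<in> space M. Y \<omega> \<in> ?A \<and> d k < Y \<omega>}"
  have "?E k \<in> events" for k by measurable
  then have "range ?E \<subseteq> events" by blast
  moreover have "decseq ?E"
    using dr unfolding decseq_def d_def by (force intro: Max_mono le_less_trans)
  moreover have "(\<Inter>k. ?E k) = {}"
  proof -
    have "\<exists>k. Y \<omega> \<le> d k" if "g (Y \<omega>) \<le> z" for \<omega>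
      using cof[OF that] dr(2) by (meson less_imp_le order_trans order_refl)
    then show ?thesis by (auto simp: set_eq_iff not_less)
  qed
  ultimately have "(\<lambda>k. prob (?E k)) \<longlonglongrightarrow> 0"
    using finite_Lim_measure_decseq[of ?E] by simp
  then have "\<forall>\<^sub>F k in sequentially. prob (?E k) < \<eta>"
    using \<open>\<eta> > 0\<close> order_tendstoD(2) by blast
  then obtain k where "prob (?E k) < \<eta>" by (auto simp: eventually_sequentially)
  then show thesis using that[of "d k"] d by simp
qed

section \<open>Monotonicity, finiteness and Markov bounds for the averaged modulus\<close>

lemma mono_tau: "mono (\<lambda>\<delta>. tau \<Theta> M' \<theta> n i \<delta> x)"
proof (rule monoI)
  fix \<delta> \<delta>' :: real assume le: "\<delta> \<le> \<delta>'"
  show "tau \<Theta> M' \<theta> n i \<delta> x \<le> tau \<Theta> M' \<theta> n i \<delta>' x"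
  \<comment> \<open>Once the larger interval leaves \<Theta>, the right side is \<infinity>; the
    convention thus preserves monotonicity.\<close>
  proof (cases "{\<theta> - \<delta>'..\<theta> + \<delta>'} \<subseteq> \<Theta>")
    case True
    then have "{\<theta> - \<delta>..\<theta> + \<delta>} \<subseteq> \<Theta>" using le by (force simp: subset_iff)
    with True show ?thesis using le by (auto simp: tau_def intro!: SUP_subset_mono)
  qed (simp add: tau_def)
qed

lemma mono_tau_bar: "mono (tau_bar P X \<Theta> M' \<theta> n)"
  unfolding tau_bar_def
  by (intro monoI mult_left_mono sum_mono nn_integral_mono) (auto intro: monoD[OF mono_tau])

text \<open>An interval leaving \<Theta> makes every summand infinite, and the nonzero
  \<open>J_n\<close> excludes both an empty sum and a zero prefactor.\<close>

lemma tau_bar_finite_imp_subset: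
  assumes "prob_space (P n)" "J_n P X M' \<theta> n \<noteq> 0" "tau_bar P X \<Theta> M' \<theta> n \<delta> < \<infinity>"
  shows "{\<theta> - \<delta>..\<theta> + \<delta>} \<subseteq> \<Theta>"
proof (rule ccontr)
  interpret prob_space "P n" by fact
  assume "\<not> {\<theta> - \<delta>..\<theta> + \<delta>} \<subseteq> \<Theta>"
  then have "tau \<Theta> M' \<theta> n i \<delta> x = \<infinity>" for i x by (simp add: tau_def)
  moreover have "n \<noteq> 0" using assms(2) by (auto simp: J_n_def intro!: Nat.gr0I)
  ultimately have "tau_bar P X \<Theta> M' \<theta> n \<delta> = \<infinity>"
    using assms(2) by (simp add: tau_bar_def emeasure_space_1 ennreal_mult_eq_top_iff
        ennreal_top_mult ennreal_mult_top)
  with assms(3) show False by simp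
qed

text \<open>The weight \<open>k\<close> covers two uses: \<open>k = 1\<close> bounds the increments
  alone, \<open>k = r * d\<close> bounds them multiplied by the scaled radius.\<close>

lemma tau_bar_Markov:
  assumes prob: "prob_space (P n)" and J: "J_n P X M' \<theta> n \<noteq> 0"
    and meas: "\<And>i. i \<in> {1..n} \<Longrightarrow> (\<lambda>\<omega>. tau \<Theta> M' \<theta> n i \<delta> (X n i \<omega>)) \<in> borel_measurable (P n)"
    and le: "ennreal k * tau_bar P X \<Theta> M' \<theta> n \<delta> \<le> ennreal (a * \<eta>)"
    and pos: "k \<ge> 0" "a > 0" "\<eta> > 0"
  obtains B where "B \<in> sets (P n)" "measure (P n) B \<le> \<eta>"
    "\<And>\<omega>. \<omega> \<in> space (P n) - B \<Longrightarrow>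
       ennreal k * (\<Sum>i=1..n. tau \<Theta> M' \<theta> n i \<delta> (X n i \<omega>)) \<le> ennreal (a * \<bar>J_n P X M' \<theta> n\<bar>)"
proof -
  interpret prob_space "P n" by (rule prob)
  let ?J = "\<bar>J_n P X M' \<theta> n\<bar>" and ?T = "\<lambda>\<omega>. \<Sum>i=1..n. tau \<Theta> M' \<theta> n i \<delta> (X n i \<omega>)"
  have Jp: "?J > 0" using J by simp
  have [measurable]: "?T \<in> borel_measurable (P n)" using meas by measurable
  \<comment> \<open>This scaling moves the threshold \<open>a * ?J\<close> to 1, the form in which
    Markov's inequality is applied.\<close>
  let ?c = "ennreal (1 / (a * ?J)) * ennreal k"
  define B where "B = {\<omega> \<in> space (P n). 1 \<le> ?c * ?T \<omega>}"
  have [measurable]: "B \<in> events" unfolding B_def by measurable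
  have "emeasure (P n) B \<le> ?c * (\<integral>\<^sup>+\<omega>. ?T \<omega> * indicator (space (P n)) \<omega> \<partial>P n)"
    unfolding B_def by (rule nn_integral_Markov_inequality) measurable
  also have "(\<integral>\<^sup>+\<omega>. ?T \<omega> * indicator (space (P n)) \<omega> \<partial>P n) = (\<integral>\<^sup>+\<omega>. ?T \<omega> \<partial>P n)"
    by (rule nn_integral_cong) simp
  also have "\<dots> = (\<Sum>i=1..n. \<integral>\<^sup>+\<omega>. tau \<Theta> M' \<theta> n i \<delta> (X n i \<omega>) \<partial>P n)"
    using meas by (rule nn_integral_sum)
  also have "?c * \<dots> = ennreal (1 / a) * (ennreal k * tau_bar P X \<Theta> M' \<theta> n \<delta>)"
    using pos Jp by (simp add: tau_bar_def ennreal_mult'[symmetric] mult.assoc[symmetric] mult_ac)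
  also have "\<dots> \<le> ennreal (1 / a) * ennreal (a * \<eta>)" using le by (rule mult_left_mono) simp
  also have "\<dots> = ennreal \<eta>" using pos by (simp add: ennreal_mult'[symmetric])
  finally have "prob B \<le> \<eta>" using pos(3) by (simp add: emeasure_eq_measure)
  moreover have "ennreal k * ?T \<omega> \<le> ennreal (a * ?J)" if "\<omega> \<in> space (P n) - B" for \<omega>
  proof -
    have "?c * ?T \<omega> \<le> 1" using that by (auto simp: B_def not_le)
    then have "ennreal (a * ?J) * (?c * ?T \<omega>) \<le> ennreal (a * ?J) * 1" by (rule mult_left_mono) simp
    moreover have "ennreal (a * ?J) * ?c = ennreal k"
      using pos Jp by (simp add: mult.assoc[symmetric] ennreal_mult'[symmetric])
    ultimately show ?thesis by (simp add: mult.assoc[symmetric])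
  qed
  ultimately show thesis using that[of B] by simp
qed

text \<open>A finite bound on a sum of nonnegative terms makes each term finite, so
  \<open>enn2real\<close> loses nothing and \<open>b\<close> supplies the real majorants for the
  expansion.\<close>

lemma tau_sum_bound:
  fixes X :: "nat \<Rightarrow> nat \<Rightarrow> 'w \<Rightarrow> 'a"
  assumes sub: "{\<theta> - \<delta>..\<theta> + \<delta>} \<subseteq> \<Theta>"
    and le: "(\<Sum>i=1..n. tau \<Theta> M' \<theta> n i \<delta> (X n i \<omega>)) \<le> ennreal y" and "y \<ge> 0"
  defines "b \<equiv> \<lambda>i. enn2real (tau \<Theta> M' \<theta> n i \<delta> (X n i \<omega>))"
  shows "\<And>i s. i \<in> {1..n} \<Longrightarrow> \<bar>s - \<theta>\<bar> \<le> \<delta> \<Longrightarrow> \<bar>M' n i s (X n i \<omega>) - M' n i \<theta> (X n i \<omega>)\<bar> \<le> b i"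
    and "(\<Sum>i=1..n. b i) \<le> y"
    and "(\<Sum>i=1..n. tau \<Theta> M' \<theta> n i \<delta> (X n i \<omega>)) = ennreal (\<Sum>i=1..n. b i)"
proof -
  have fin: "tau \<Theta> M' \<theta> n i \<delta> (X n i \<omega>) = ennreal (b i)" if "i \<in> {1..n}" for i
  proof -
    have "tau \<Theta> M' \<theta> n i \<delta> (X n i \<omega>) \<le> (\<Sum>i=1..n. tau \<Theta> M' \<theta> n i \<delta> (X n i \<omega>))"
      using that by (intro member_le_sum) auto
    also have "\<dots> < \<infinity>" using le by (rule le_less_trans) simp
    finally show ?thesis by (simp add: b_def)
  qed
  show "\<bar>M' n i s (X n i \<omega>) - M' n i \<theta> (X n i \<omega>)\<bar> \<le> b i" if "i \<in> {1..n}" "\<bar>s - \<theta>\<bar> \<le> \<delta>" for i s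
  proof -
    have "ennreal \<bar>M' n i s (X n i \<omega>) - M' n i \<theta> (X n i \<omega>)\<bar> \<le> tau \<Theta> M' \<theta> n i \<delta> (X n i \<omega>)"
      using sub that(2) by (auto simp: tau_def intro!: SUP_upper)
    also note fin[OF that(1)]
    finally show ?thesis by (simp add: b_def)
  qed
  show eq: "(\<Sum>i=1..n. tau \<Theta> M' \<theta> n i \<delta> (X n i \<omega>)) = ennreal (\<Sum>i=1..n. b i)"
    using fin by (subst sum_ennreal[symmetric]) (auto simp: b_def)
  show "(\<Sum>i=1..n. b i) \<le> y" using le \<open>y \<ge> 0\<close> unfolding eq by simp
qed

lemma (in prob_space) measure_Un_le_add:
  assumes "A \<in> events" "B \<in> events" "prob A \<le> a" "prob B \<le> b"
  shows "prob (A \<union> B) \<le> a + b"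
  using measure_Un_le[OF assms(1,2)] assms(3,4) by linarith

text \<open>
  No consistency of the estimator is assumed: a radius \<open>d > \<delta>\<close> is harmless because then
  \<open>r * d \<ge> 1\<close>, so a small \<open>r * d * tau_bar d\<close> already makes \<open>tau_bar d\<close> small.
\<close>

lemma deterministic_radius:
  fixes X :: "nat \<Rightarrow> nat \<Rightarrow> 'w \<Rightarrow> 'a" and Y :: "'w \<Rightarrow> real" and a r \<delta> \<eta> \<theta> :: real
    and \<Theta> :: "real set" and M' :: "nat \<Rightarrow> nat \<Rightarrow> real \<Rightarrow> 'a \<Rightarrow> real"
  defines "T \<equiv> \<lambda>n d \<omega>. \<Sum>i=1..n. tau \<Theta> M' \<theta> n i d (X n i \<omega>)"
  assumes prob: "prob_space (P n)" and J: "J_n P X M' \<theta> n \<noteq> 0"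
    and meas: "\<And>i d. i \<in> {1..n} \<Longrightarrow> d \<ge> 0 \<Longrightarrow>
        (\<lambda>\<omega>. tau \<Theta> M' \<theta> n i d (X n i \<omega>)) \<in> borel_measurable (P n)"
    and Y [measurable]: "Y \<in> borel_measurable (P n)"
    and pos: "a > 0" "\<eta> > 0" "r \<ge> 0" and r: "r * \<delta> \<ge> 1"
    and \<delta>: "tau_bar P X \<Theta> M' \<theta> n \<delta> \<le> ennreal (a * \<eta>)"
    and Y_small: "measure (P n) {\<omega> \<in> space (P n).
        ennreal (r * Y \<omega>) * tau_bar P X \<Theta> M' \<theta> n (Y \<omega>) > ennreal (a * \<eta>)} \<le> \<eta>"
  obtains d B where "d \<ge> 0" "{\<theta> - d..\<theta> + d} \<subseteq> \<Theta>" "B \<in> sets (P n)" "measure (P n) B \<le> 4 * \<eta>"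
    "\<forall>\<omega>\<in>space (P n) - B. Y \<omega> \<le> d \<and> T n d \<omega> \<le> ennreal (a * \<bar>J_n P X M' \<theta> n\<bar>)
       \<and> ennreal (r * d) * T n d \<omega> \<le> ennreal (a * \<bar>J_n P X M' \<theta> n\<bar>)"
proof -
  interpret prob_space "P n" by (rule prob)
  let ?\<tau> = "tau_bar P X \<Theta> M' \<theta> n" and ?J = "\<bar>J_n P X M' \<theta> n\<bar>"
  \<comment> \<open>Being monotone with \<open>g 0 = 0\<close>, \<open>g\<close> turns smallness at
    the random point \<open>Y\<close> into an upper bound on \<open>Y\<close>, up to the slack of
    the approximate quantile.\<close>
  define g where "g y = ennreal (r * y) * ?\<tau> y" for y
  have g: "mono g"
    unfolding g_def
    by (intro monoI mult_mono ennreal_leI mult_left_mono monoD[OF mono_tau_bar]) (auto simp: pos)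
  obtain d where d: "d \<ge> 0" "g d \<le> ennreal (a * \<eta>)"
    and tail: "prob {\<omega> \<in> space (P n). g (Y \<omega>) \<le> ennreal (a * \<eta>) \<and> d < Y \<omega>} \<le> \<eta>"
    by (rule approximate_quantile[OF Y g _ pos(2), of "ennreal (a * \<eta>)"]) (auto simp: g_def)
  have le: "?\<tau> d \<le> ennreal (a * \<eta>)"
  proof (cases "d \<le> \<delta>")
    case True
    then show ?thesis using monoD[OF mono_tau_bar] \<delta> by (meson order_trans)
  next
    case False
    then have "1 \<le> r * d" using r pos(3) mult_left_mono[of \<delta> d r] by linarith
    then have "1 * ?\<tau> d \<le> g d"
      unfolding g_def by (intro mult_right_mono) (auto simp: ennreal_1[symmetric] simp del: ennreal_1)
    then show ?thesis using d(2) by simp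
  qed
  then have "?\<tau> d < \<infinity>" by (rule le_less_trans) simp
  note sub = tau_bar_finite_imp_subset[OF prob J this]
  obtain B1 where B1: "B1 \<in> events" "prob B1 \<le> \<eta>"
    "\<And>\<omega>. \<omega> \<in> space (P n) - B1 \<Longrightarrow> ennreal 1 * T n d \<omega> \<le> ennreal (a * ?J)"
    unfolding T_def
    by (rule tau_bar_Markov[OF prob J meas, of d 1 a \<eta>]) (use le pos d(1) in auto)
  obtain B2 where B2: "B2 \<in> events" "prob B2 \<le> \<eta>"
    "\<And>\<omega>. \<omega> \<in> space (P n) - B2 \<Longrightarrow> ennreal (r * d) * T n d \<omega> \<le> ennreal (a * ?J)"
    unfolding T_def
    by (rule tau_bar_Markov[OF prob J meas, of d "r * d" a \<eta>]) (use d pos in \<open>auto simp: g_def\<close>)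
  \<comment> \<open>Four exceptional events, each of probability at most \<open>\<eta>\<close>:
    smallness of \<open>g\<close> at \<open>Y\<close> fails, \<open>Y\<close> exceeds
    \<open>d\<close> although \<open>g\<close> is small, and the two Markov events.\<close>
  let ?E = "{\<omega> \<in> space (P n). g (Y \<omega>) > ennreal (a * \<eta>)}"
  let ?F = "{\<omega> \<in> space (P n). g (Y \<omega>) \<le> ennreal (a * \<eta>) \<and> d < Y \<omega>}"
  let ?A = "{y. g y \<le> ennreal (a * \<eta>)}"
  have [measurable]: "?A \<in> sets borel" by (rule sublevel_mono_borel[OF g])
  have "{\<omega> \<in> space (P n). Y \<omega> \<notin> ?A} \<in> events" "{\<omega> \<in> space (P n). Y \<omega> \<in> ?A \<and> d < Y \<omega>} \<in> events"
    by measurable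
  then have E: "?E \<in> events" and F: "?F \<in> events" by (auto simp: not_le)
  have "prob ?E \<le> \<eta>" using Y_small by (simp add: g_def)
  then have "prob ((?E \<union> ?F) \<union> (B1 \<union> B2)) \<le> (\<eta> + \<eta>) + (\<eta> + \<eta>)"
    using E F B1(1,2) B2(1,2) tail by (intro measure_Un_le_add) auto
  then show thesis
    using E F B1(1,3) B2(1,3) d(1) sub
    by (intro that[of d "(?E \<union> ?F) \<union> (B1 \<union> B2)"]) (auto simp: not_less not_le)
qed

subsection \<open>Measurability\<close>

text \<open>Joint measurability is given over \<Theta>, so the random argument is regarded as a map
  into the restricted space.\<close>

lemma measurable_random_argument:
  assumes F: "(\<lambda>(t, x). F t x) \<in> borel_measurable (restrict_space borel \<Theta> \<Otimes>\<^sub>M S)"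
    and [measurable]: "u \<in> borel_measurable N" "X \<in> measurable N S"
    and \<Theta>: "\<And>\<omega>. \<omega> \<in> space N \<Longrightarrow> u \<omega> \<in> \<Theta>"
  shows "(\<lambda>\<omega>. F (u \<omega>) (X \<omega>)) \<in> borel_measurable N"
proof -
  have "u \<in> measurable N (restrict_space borel \<Theta>)"
    using \<Theta> by (intro measurable_restrict_space2) auto
  then have "(\<lambda>\<omega>. (u \<omega>, X \<omega>)) \<in> measurable N (restrict_space borel \<Theta> \<Otimes>\<^sub>M S)"
    by measurable
  from measurable_compose[OF this F] show ?thesis by simp
qed

lemma measurable_studentized_error:
  fixes X :: "nat \<Rightarrow> nat \<Rightarrow> 'w \<Rightarrow> 'a"
  assumes X: "\<And>i. i \<in> {1..n} \<Longrightarrow> X n i \<in> measurable N S"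
    and \<Theta>: "\<Theta> \<in> sets borel" "\<theta> \<in> \<Theta>"
    and M: "\<And>i. i \<in> {1..n} \<Longrightarrow>
      (\<lambda>(t, x). M n i t x) \<in> borel_measurable (restrict_space borel \<Theta> \<Otimes>\<^sub>M S)"
    and M': "\<And>i. i \<in> {1..n} \<Longrightarrow>
      (\<lambda>(t, x). M' n i t x) \<in> borel_measurable (restrict_space borel \<Theta> \<Otimes>\<^sub>M S)"
    and est [measurable]: "estimate est X n \<in> borel_measurable N"
  shows "{\<omega> \<in> space N. d_defined \<Theta> M M' X est n \<omega>} \<in> sets N"
    and "studentized_error \<Theta> M M' X est \<theta> n \<in> borel_measurable N"
proof -
  note [measurable] = \<Theta>(1)
  \<comment> \<open>\<open>M\<close> and \<open>M'\<close> are measurable only on \<open>\<Theta>\<close>, so arguments outside \<open>\<Theta>\<close> are moved to \<open>\<theta>\<close>.\<close>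
  define t where "t \<omega> = (if estimate est X n \<omega> \<in> \<Theta> then estimate est X n \<omega> else \<theta>)" for \<omega>
  have [measurable]: "t \<in> borel_measurable N" unfolding t_def by measurable
  have t\<Theta>: "t \<omega> \<in> \<Theta>" for \<omega> using \<Theta>(2) by (simp add: t_def)
  define s where "s \<omega> = sample_sum M X n (t \<omega>) \<omega>" for \<omega>
  define s' where "s' \<omega> = sample_sum M' X n (t \<omega>) \<omega>" for \<omega>
  have [measurable]: "s \<in> borel_measurable N"
    unfolding s_def sample_sum_def
    by (intro borel_measurable_sum, rule measurable_random_argument[OF M _ X]) (simp_all add: t\<Theta>)
  have [measurable]: "s' \<in> borel_measurable N"
    unfolding s'_def sample_sum_def
    by (intro borel_measurable_sum, rule measurable_random_argument[OF M' _ X]) (simp_all add: t\<Theta>)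
  define u where "u \<omega> = t \<omega> - s \<omega> / s' \<omega>" for \<omega>
  have [measurable]: "u \<in> borel_measurable N" unfolding u_def by measurable
  define u' where "u' \<omega> = (if u \<omega> \<in> \<Theta> then u \<omega> else \<theta>)" for \<omega>
  have [measurable]: "u' \<in> borel_measurable N" unfolding u'_def by measurable
  have u'\<Theta>: "u' \<omega> \<in> \<Theta>" for \<omega> using \<Theta>(2) by (simp add: u'_def)
  define q where "q \<omega> = sample_sum_sq M X n (u' \<omega>) \<omega>" for \<omega>
  have [measurable]: "q \<in> borel_measurable N"
    unfolding q_def sample_sum_sq_def
    by (intro borel_measurable_sum borel_measurable_power, rule measurable_random_argument[OF M _ X])
      (simp_all add: u'\<Theta>)
  \<comment> \<open>Moved and original arguments agree when they lie in \<Theta>; otherwise a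
    membership conjunct is already false on both sides.\<close>
  have def: "d_defined \<Theta> M M' X est n \<omega> \<longleftrightarrow>
      estimate est X n \<omega> \<in> \<Theta> \<and> s' \<omega> \<noteq> 0 \<and> u \<omega> \<in> \<Theta> \<and> q \<omega> \<noteq> 0" for \<omega>
    by (auto simp: d_defined_def s'_def s_def u_def u'_def q_def t_def one_step_def)
  show D: "{\<omega> \<in> space N. d_defined \<Theta> M M' X est n \<omega>} \<in> sets N"
    unfolding def by measurable
  have "studentized_error \<Theta> M M' X est \<theta> n =
      (\<lambda>\<omega>. if d_defined \<Theta> M M' X est n \<omega> then s' \<omega> / sqrt (q \<omega>) * (u \<omega> - \<theta>) else 0)"
    by (auto simp: studentized_error_def d_stat_def d_defined_def s'_def s_def u_def u'_def q_def
        t_def one_step_def)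
  also have "\<dots> \<in> borel_measurable N"
    by (rule measurable_If[OF _ _ D]) measurable
  finally show "studentized_error \<Theta> M M' X est \<theta> n \<in> borel_measurable N" .
qed

subsection \<open>Asymptotic normality\<close>

theorem mainTheorem2:
  fixes P :: "nat \<Rightarrow> 'w measure"
    and S :: "nat \<Rightarrow> 'a measure"
    and X :: "nat \<Rightarrow> nat \<Rightarrow> 'w \<Rightarrow> 'a"
    and \<Theta> :: "real set"
    and \<theta> :: real
    and M M' :: "nat \<Rightarrow> nat \<Rightarrow> real \<Rightarrow> 'a \<Rightarrow> real"
    and est :: "nat \<Rightarrow> (nat \<Rightarrow> 'a) \<Rightarrow> real"
  assumes prob: "\<And>n. prob_space (P n)"
    and indep: "\<And>n. prob_space.indep_vars (P n) (\<lambda>i. S n) (X n) {1..n}"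
    and Theta: "open \<Theta>" "\<theta> \<in> \<Theta>"
    and M_meas: "\<And>n i. i \<in> {1..n} \<Longrightarrow>
        (\<lambda>(t, x). M n i t x) \<in> borel_measurable (restrict_space borel \<Theta> \<Otimes>\<^sub>M S n)"
    and M'_meas: "\<And>n i. i \<in> {1..n} \<Longrightarrow>
        (\<lambda>(t, x). M' n i t x) \<in> borel_measurable (restrict_space borel \<Theta> \<Otimes>\<^sub>M S n)"
    and tau_meas: "\<And>n i \<delta>. i \<in> {1..n} \<Longrightarrow> \<delta> \<ge> 0 \<Longrightarrow>
        (\<lambda>\<omega>. tau \<Theta> M' \<theta> n i \<delta> (X n i \<omega>)) \<in> borel_measurable (P n)"
    and est_meas: "\<And>n. est n \<in> borel_measurable (PiM {1..n} (\<lambda>i. S n))"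
    and a_int: "\<And>n i. i \<in> {1..n} \<Longrightarrow>
        AE \<omega> in P n. \<forall>t1 t2. t1 < t2 \<and> {t1..t2} \<subseteq> \<Theta> \<longrightarrow>
          set_integrable lborel {t1..t2} (\<lambda>t. M' n i t (X n i \<omega>)) \<and>
          M n i t2 (X n i \<omega>) - M n i t1 (X n i \<omega>) = (LINT t:{t1..t2}|lborel. M' n i t (X n i \<omega>))"
    and a_M_sq: "\<And>n i. i \<in> {1..n} \<Longrightarrow> integrable (P n) (\<lambda>\<omega>. (M n i \<theta> (X n i \<omega>))\<^sup>2)"
    and a_M_mean: "\<And>n i. i \<in> {1..n} \<Longrightarrow> (\<integral>\<omega>. M n i \<theta> (X n i \<omega>) \<partial>P n) = 0"
    and a_M'_int: "\<And>n i. i \<in> {1..n} \<Longrightarrow> integrable (P n) (\<lambda>\<omega>. M' n i \<theta> (X n i \<omega>))"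
    and b_pos: "eventually (\<lambda>n. I_n P X M \<theta> n > 0 \<and> J_n P X M' \<theta> n \<noteq> 0) sequentially"
    and b_ratio: "filterlim (\<lambda>n. \<bar>J_n P X M' \<theta> n\<bar> / sqrt (I_n P X M \<theta> n)) at_top sequentially"
    and b_lln: "conv_in_prob P (\<lambda>n \<omega>. sample_sum M' X n \<theta> \<omega> / J_n P X M' \<theta> n) 1"
    and b_clt: "weak_conv_m
        (\<lambda>n. distr (P n) borel (\<lambda>\<omega>. sample_sum M X n \<theta> \<omega> / sqrt (I_n P X M \<theta> n)))
        std_normal_distribution"
    and c_tau: "((\<lambda>\<delta>. limsup (\<lambda>n. tau_bar P X \<Theta> M' \<theta> n \<delta>)) \<longlongrightarrow> 0) (at_right 0)"
    and d_est: "conv_in_prob_0 P (\<lambda>n \<omega>.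
        ennreal (\<bar>J_n P X M' \<theta> n\<bar> / sqrt (I_n P X M \<theta> n) * \<bar>estimate est X n \<omega> - \<theta>\<bar>)
        * tau_bar P X \<Theta> M' \<theta> n \<bar>estimate est X n \<omega> - \<theta>\<bar>)"
    and e_M': "conv_in_prob P (\<lambda>n \<omega>. sample_sum_sq M' X n \<theta> \<omega> / (J_n P X M' \<theta> n)\<^sup>2) 0"
    and e_M: "conv_in_prob P (\<lambda>n \<omega>. sample_sum_sq M X n \<theta> \<omega> / I_n P X M \<theta> n) 1"
  shows "(\<lambda>n. measure (P n) {\<omega> \<in> space (P n). d_defined \<Theta> M M' X est n \<omega>}) \<longlonglongrightarrow> 1 \<and>
    weak_conv_m (\<lambda>n. distr (P n) borel (studentized_error \<Theta> M M' X est \<theta> n))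
      std_normal_distribution"
proof (rule conjI)
  have X: "X n i \<in> measurable (P n) (S n)" if "i \<in> {1..n}" for n i
    using indep[of n] that unfolding prob_space.indep_vars_def[OF prob[of n]] by blast
  have est: "estimate est X n \<in> borel_measurable (P n)" for n
    unfolding estimate_def[abs_def]
    by (rule measurable_compose[OF measurable_restrict est_meas]) (rule X)
  have M_\<theta> [measurable]: "(\<lambda>\<omega>. M n i \<theta> (X n i \<omega>)) \<in> borel_measurable (P n)" if "i \<in> {1..n}" for n i
    by (rule measurable_random_argument[OF M_meas[OF that] _ X[OF that]]) (simp_all add: Theta)
  have M'_\<theta> [measurable]: "(\<lambda>\<omega>. M' n i \<theta> (X n i \<omega>)) \<in> borel_measurable (P n)" if "i \<in> {1..n}" for n i
    by (rule measurable_random_argument[OF M'_meas[OF that] _ X[OF that]]) (simp_all add: Theta)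
  define I where "I n = I_n P X M \<theta> n" for n
  define J where "J n = J_n P X M' \<theta> n" for n
  define W where "W n \<omega> = sample_sum M X n \<theta> \<omega> / sqrt (I n)" for n \<omega>
  define Z where "Z n = studentized_error \<Theta> M M' X est \<theta> n" for n
  define T where "T n d \<omega> = (\<Sum>i=1..n. tau \<Theta> M' \<theta> n i d (X n i \<omega>))" for n d \<omega>
  have W_meas: "W n \<in> borel_measurable (P n)" for n
    unfolding W_def sample_sum_def by measurable
  have borel_\<Theta>: "\<Theta> \<in> sets borel" using Theta(1) by simp
  note meas = measurable_studentized_error[OF X borel_\<Theta> Theta(2) M_meas M'_meas est]
  have clt: "weak_conv_m (\<lambda>n. distr (P n) borel (W n)) std_normal_distribution"
    using b_clt by (simp add: W_def[abs_def] I_def)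

  \<comment> \<open>One \<open>\<eta>\<close> is both accuracy and exceptional probability. The two
    conjuncts lead to the two conclusions.\<close>
  have main: "whp P \<eta> (\<lambda>n \<omega>. d_defined \<Theta> M M' X est n \<omega> \<and> \<bar>Z n \<omega> + W n \<omega>\<bar> \<le> \<eta>)"
    if "\<eta> > 0" for \<eta> :: real
  proof -
    \<comment> \<open>Ten shares: six events cost \<open>\<alpha>\<close> each and the radius costs
      \<open>4 * \<alpha>\<close>.\<close>
    define \<alpha> where "\<alpha> = \<eta> / 10"
    have \<alpha>: "\<alpha> > 0" using that by (simp add: \<alpha>_def)
    obtain K where K: "K \<ge> 1" and tight: "whp P \<alpha> (\<lambda>n \<omega>. \<bar>W n \<omega>\<bar> \<le> K)"
      using weak_conv_std_normal_tight[OF clt W_meas prob \<alpha>] by blast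
    \<comment> \<open>The choices are nested: \<open>K\<close> from tightness, \<open>e\<close> from
      \<open>K\<close>, \<open>\<delta>\<close> from \<open>e\<close>, then large \<open>n\<close>.
      The two terms meet the smallness hypothesis of the expansion and bring its error below
      \<open>\<eta>\<close>.\<close>
    define e where "e = min (1 / (40 * K)) (\<eta> / (22 * K\<^sup>2))"
    have e: "e > 0" "40 * K * e \<le> 1" "22 * K\<^sup>2 * e \<le> \<eta>"
    proof -
      show "e > 0" using K that by (simp add: e_def)
      have "e \<le> 1 / (40 * K)" by (simp add: e_def)
      then show "40 * K * e \<le> 1" using K by (simp add: le_divide_eq mult_ac)
      have "e \<le> \<eta> / (22 * K\<^sup>2)" by (simp add: e_def)
      then show "22 * K\<^sup>2 * e \<le> \<eta>" using K by (simp add: le_divide_eq mult_ac)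
    qed
    then have e2: "e\<^sup>2 > 0" by simp
    \<comment> \<open>At level \<open>e\<^sup>2 * \<alpha>\<close>, Markov's inequality bounds the
      sum by \<open>e\<^sup>2 * \<bar>J n\<bar>\<close> at the price of probability
      \<open>\<alpha>\<close>.\<close>
    have "\<forall>\<^sub>F \<delta> in at_right 0. limsup (\<lambda>n. tau_bar P X \<Theta> M' \<theta> n \<delta>) < ennreal (e\<^sup>2 * \<alpha>)"
      using order_tendstoD(2)[OF c_tau, of "ennreal (e\<^sup>2 * \<alpha>)"] e2 \<alpha> by simp
    from eventually_happens[OF eventually_conj[OF this eventually_at_right_less[of 0]]]
    obtain \<delta> where \<delta>: "\<delta> > 0" "limsup (\<lambda>n. tau_bar P X \<Theta> M' \<theta> n \<delta>) < ennreal (e\<^sup>2 * \<alpha>)"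
      by auto
    have ev_\<tau>: "\<forall>\<^sub>F n in sequentially. tau_bar P X \<Theta> M' \<theta> n \<delta> \<le> ennreal (e\<^sup>2 * \<alpha>)"
      using Limsup_lessD[OF \<delta>(2)] by eventually_elim simp
    \<comment> \<open>This keeps the updated point within \<open>\<delta>\<close>; as
      \<open>K \<ge> 1\<close>, it also makes the ratio times \<open>\<delta>\<close> at least 1, as
      \<open>deterministic_radius\<close> requires.\<close>
    have ev_r: "\<forall>\<^sub>F n in sequentially. \<bar>J n\<bar> / sqrt (I n) \<ge> 4 * K / \<delta>"
      using b_ratio unfolding filterlim_at_top I_def J_def by blast
    have ev_pos: "\<forall>\<^sub>F n in sequentially. I n > 0 \<and> J n \<noteq> 0"
      using b_pos by (simp add: I_def J_def)

    have LLN: "whp P \<alpha> (\<lambda>n \<omega>. \<bar>sample_sum M' X n \<theta> \<omega> / J n - 1\<bar> \<le> e\<^sup>2)"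
      by (rule whp_conv_in_prob[OF b_lln[folded J_def] _ e2 \<alpha>]) (unfold sample_sum_def, measurable)
    have sq': "whp P \<alpha> (\<lambda>n \<omega>. \<bar>sample_sum_sq M' X n \<theta> \<omega> / (J n)\<^sup>2 - 0\<bar> \<le> e\<^sup>2)"
      by (rule whp_conv_in_prob[OF e_M'[folded J_def] _ e2 \<alpha>]) (unfold sample_sum_sq_def, measurable)
    have sq: "whp P \<alpha> (\<lambda>n \<omega>. \<bar>sample_sum_sq M X n \<theta> \<omega> / I n - 1\<bar> \<le> e\<^sup>2)"
      by (rule whp_conv_in_prob[OF e_M[folded I_def] _ e2 \<alpha>]) (unfold sample_sum_sq_def, measurable)
    have FTC: "whp P \<alpha> (\<lambda>n \<omega>. \<forall>i\<in>{1..n}. \<forall>t1 t2. t1 < t2 \<and> {t1..t2} \<subseteq> \<Theta> \<longrightarrow>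
        set_integrable lborel {t1..t2} (\<lambda>t. M' n i t (X n i \<omega>)) \<and>
        M n i t2 (X n i \<omega>) - M n i t1 (X n i \<omega>) = (LINT t:{t1..t2}|lborel. M' n i t (X n i \<omega>)))"
      by (rule whp_AE, rule always_eventually, rule allI, rule AE_finite_allI)
        (rule finite_atLeastAtMost, erule a_int, use \<alpha> in simp)
    have T\<delta>: "whp P \<alpha> (\<lambda>n \<omega>. T n \<delta> \<omega> \<le> ennreal (e\<^sup>2 * \<bar>J n\<bar>))"
      unfolding whp_def using ev_\<tau> ev_pos
    proof eventually_elim
      case (elim n)
      have Jn: "J_n P X M' \<theta> n \<noteq> 0" using elim by (simp add: J_def)
      obtain B where "B \<in> sets (P n)" "measure (P n) B \<le> \<alpha>"
        "\<And>\<omega>. \<omega> \<in> space (P n) - B \<Longrightarrow> ennreal 1 * T n \<delta> \<omega> \<le> ennreal (e\<^sup>2 * \<bar>J n\<bar>)"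
        unfolding T_def J_def
        by (rule tau_bar_Markov[OF prob Jn tau_meas, of \<delta> 1 "e\<^sup>2" \<alpha>]) (use elim e2 \<alpha> \<delta>(1) in auto)
      then show ?case by auto
    qed
    \<comment> \<open>Condition (d) enters here, with the ratio
      \<open>\<bar>J n\<bar> / sqrt (I n)\<close> in the role of \<open>r\<close>. The
      \<open>d\<close> obtained depends on \<open>n\<close> but not on the outcome.\<close>
    have radius: "whp P (4 * \<alpha>) (\<lambda>n \<omega>. \<exists>d. {\<theta> - d..\<theta> + d} \<subseteq> \<Theta> \<and> \<bar>estimate est X n \<omega> - \<theta>\<bar> \<le> d
        \<and> T n d \<omega> \<le> ennreal (e\<^sup>2 * \<bar>J n\<bar>)
        \<and> ennreal (\<bar>J n\<bar> / sqrt (I n) * d) * T n d \<omega> \<le> ennreal (e\<^sup>2 * \<bar>J n\<bar>))"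
    proof -
      have "(\<lambda>n. measure (P n) {\<omega> \<in> space (P n).
          ennreal (\<bar>J n\<bar> / sqrt (I n) * \<bar>estimate est X n \<omega> - \<theta>\<bar>)
          * tau_bar P X \<Theta> M' \<theta> n \<bar>estimate est X n \<omega> - \<theta>\<bar> > ennreal (e\<^sup>2 * \<alpha>)}) \<longlonglongrightarrow> 0"
        using d_est e2 \<alpha> unfolding conv_in_prob_0_def I_def J_def by simp
      from order_tendstoD(2)[OF this \<alpha>] ev_\<tau> ev_pos ev_r show ?thesis
        unfolding whp_def
      proof eventually_elim
        case (elim n)
        have Jn: "J_n P X M' \<theta> n \<noteq> 0" using elim by (simp add: J_def)
        have "4 * K \<le> \<bar>J n\<bar> / sqrt (I n) * \<delta>" using elim(4) \<delta>(1) by (simp add: divide_le_eq)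
        then have r: "\<bar>J n\<bar> / sqrt (I n) * \<delta> \<ge> 1" using K by linarith
        have r0: "\<bar>J n\<bar> / sqrt (I n) \<ge> 0" using elim(3) by simp
        have Y: "(\<lambda>\<omega>. \<bar>estimate est X n \<omega> - \<theta>\<bar>) \<in> borel_measurable (P n)"
          using est[of n] by measurable
        obtain d B where "d \<ge> 0" and d: "{\<theta> - d..\<theta> + d} \<subseteq> \<Theta>"
          and B: "B \<in> sets (P n)" "measure (P n) B \<le> 4 * \<alpha>"
          and "\<forall>\<omega>\<in>space (P n) - B. \<bar>estimate est X n \<omega> - \<theta>\<bar> \<le> d
            \<and> T n d \<omega> \<le> ennreal (e\<^sup>2 * \<bar>J n\<bar>)
            \<and> ennreal (\<bar>J n\<bar> / sqrt (I n) * d) * T n d \<omega> \<le> ennreal (e\<^sup>2 * \<bar>J n\<bar>)"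
          by (rule deterministic_radius[OF prob Jn tau_meas Y e2 \<alpha> r0 r elim(2) less_imp_le[OF elim(1)],
              folded T_def J_def]) (assumption, assumption, rule that)
        with d B show ?case by (intro bexI[of _ B] conjI ballI exI[of _ d]) auto
      qed
    qed
    have expansion: "d_defined \<Theta> M M' X est n \<omega> \<and> \<bar>Z n \<omega> + W n \<omega>\<bar> \<le> \<eta>"
      if pos: "I n > 0" "J n \<noteq> 0" and r: "\<bar>J n\<bar> / sqrt (I n) \<ge> 4 * K / \<delta>"
          and \<tau>: "tau_bar P X \<Theta> M' \<theta> n \<delta> \<le> ennreal (e\<^sup>2 * \<alpha>)"
          and LLN: "\<bar>sample_sum M' X n \<theta> \<omega> / J n - 1\<bar> \<le> e\<^sup>2"
          and sq': "\<bar>sample_sum_sq M' X n \<theta> \<omega> / (J n)\<^sup>2 - 0\<bar> \<le> e\<^sup>2"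
          and sq: "\<bar>sample_sum_sq M X n \<theta> \<omega> / I n - 1\<bar> \<le> e\<^sup>2"
          and FTC: "\<forall>i\<in>{1..n}. \<forall>t1 t2. t1 < t2 \<and> {t1..t2} \<subseteq> \<Theta> \<longrightarrow>
            set_integrable lborel {t1..t2} (\<lambda>t. M' n i t (X n i \<omega>)) \<and>
            M n i t2 (X n i \<omega>) - M n i t1 (X n i \<omega>) = (LINT t:{t1..t2}|lborel. M' n i t (X n i \<omega>))"
          and W: "\<bar>W n \<omega>\<bar> \<le> K" and T\<delta>: "T n \<delta> \<omega> \<le> ennreal (e\<^sup>2 * \<bar>J n\<bar>)"
          and d: "{\<theta> - d..\<theta> + d} \<subseteq> \<Theta>" "\<bar>estimate est X n \<omega> - \<theta>\<bar> \<le> d"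
          and Td: "T n d \<omega> \<le> ennreal (e\<^sup>2 * \<bar>J n\<bar>)"
            "ennreal (\<bar>J n\<bar> / sqrt (I n) * d) * T n d \<omega> \<le> ennreal (e\<^sup>2 * \<bar>J n\<bar>)"
      for n \<omega> d
    proof -
      have eJ: "e\<^sup>2 * \<bar>J n\<bar> \<ge> 0" using e2 by simp
      have d0: "d \<ge> 0" using d(2) by linarith
      have "tau_bar P X \<Theta> M' \<theta> n \<delta> < \<infinity>" using \<tau> by (rule le_less_trans) simp
      then have sub\<delta>: "{\<theta> - \<delta>..\<theta> + \<delta>} \<subseteq> \<Theta>"
        by (rule tau_bar_finite_imp_subset[OF prob pos(2)[unfolded J_def]])
      define b where "b i = enn2real (tau \<Theta> M' \<theta> n i d (X n i \<omega>))" for i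
      define c where "c i = enn2real (tau \<Theta> M' \<theta> n i \<delta> (X n i \<omega>))" for i
      note b = tau_sum_bound[where X = X and M' = M' and n = n and \<omega> = \<omega>,
        OF d(1) Td(1)[unfolded T_def] eJ, folded b_def]
      note c = tau_sum_bound[where X = X and M' = M' and n = n and \<omega> = \<omega>,
        OF sub\<delta> T\<delta>[unfolded T_def] eJ, folded c_def]
      have b0: "(\<Sum>i=1..n. b i) \<ge> 0" by (simp add: b_def sum_nonneg)
      \<comment> \<open>Read in the reals, the weighted bound allows \<open>\<bar>J n\<bar>\<close>
        to be cancelled, leaving the bound by \<open>e\<^sup>2 * sqrt (I n)\<close> that controls
        the Newton remainder.\<close>
      have "ennreal (\<bar>J n\<bar> / sqrt (I n) * d * (\<Sum>i=1..n. b i)) \<le> ennreal (e\<^sup>2 * \<bar>J n\<bar>)"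
        using Td(2) b(3) b0 d0 pos(1) by (simp add: T_def ennreal_mult'[symmetric])
      then have "\<bar>J n\<bar> / sqrt (I n) * d * (\<Sum>i=1..n. b i) \<le> e\<^sup>2 * \<bar>J n\<bar>"
        using eJ by simp
      then have db: "d * (\<Sum>i=1..n. b i) \<le> e\<^sup>2 * sqrt (I n)"
        using pos(1) pos(2) by (simp add: field_simps)
      have J\<delta>: "4 * K * sqrt (I n) \<le> \<delta> * \<bar>J n\<bar>"
        using r pos(1) \<delta>(1) by (simp add: field_simps)
      have sq'': "(\<Sum>i=1..n. (M' n i \<theta> (X n i \<omega>))\<^sup>2) / (J n)\<^sup>2 \<le> e\<^sup>2"
        using sq' by (simp add: sample_sum_sq_def sum_nonneg)
      note exp = one_step_expansion[where A = "{1..n}" and m = "\<lambda>i t. M n i t (X n i \<omega>)"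
          and m' = "\<lambda>i t. M' n i t (X n i \<omega>)" and t = "estimate est X n \<omega>"
          and J = "J n" and I = "I n" and e = e and K = K and \<theta> = \<theta> and d = d and b = b
          and \<delta> = \<delta> and c = c and \<Theta> = \<Theta>]
      note hyps = FTC[THEN bspec] pos(2,1) e(1) K e(2) d b(1,2) db sub\<delta> \<delta>(1) J\<delta> c(1,2)
        LLN[unfolded sample_sum_def] sq'' W[unfolded W_def sample_sum_def]
        sq[unfolded sample_sum_sq_def]
      have "estimate est X n \<omega> \<in> \<Theta>" using d by (auto simp: abs_le_iff)
      moreover have "sample_sum M' X n (estimate est X n \<omega>) \<omega> \<noteq> 0"
        unfolding sample_sum_def by (rule exp(1)) (fact hyps)+
      moreover have "one_step M M' X est n \<omega> \<in> \<Theta>"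
        unfolding one_step_def sample_sum_def by (rule exp(2)) (fact hyps)+
      moreover have "sample_sum_sq M X n (one_step M M' X est n \<omega>) \<omega> \<noteq> 0"
        unfolding one_step_def sample_sum_def sample_sum_sq_def by (rule exp(3)) (fact hyps)+
      ultimately have def: "d_defined \<Theta> M M' X est n \<omega>" by (simp add: d_defined_def)
      then have "\<bar>Z n \<omega> + W n \<omega>\<bar>
          = \<bar>d_stat M M' X est n \<omega> * (one_step M M' X est n \<omega> - \<theta>) + W n \<omega>\<bar>"
        by (simp add: Z_def studentized_error_def)
      also have "\<dots> \<le> 22 * K\<^sup>2 * e"
        unfolding d_stat_def one_step_def W_def sample_sum_def sample_sum_sq_def
        by (rule exp(4)) (fact hyps)+
      finally show ?thesis using def e(3) by simp
    qed
    note whp = whp_conj[OF whp_conj[OF whp_conj[OF LLN sq' prob] whp_conj[OF sq FTC prob] prob]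
        whp_conj[OF whp_conj[OF tight T\<delta> prob] radius prob] prob]
    have "\<alpha> + \<alpha> + (\<alpha> + \<alpha>) + (\<alpha> + \<alpha> + 4 * \<alpha>) = \<eta>" by (simp add: \<alpha>_def)
    from whp[unfolded this] show ?thesis
      by (rule whp_mono, use ev_\<tau> ev_pos ev_r in eventually_elim) 
        (intro ballI impI, elim conjE exE, rule expansion, assumption+)
  qed

  have "whp P \<eta> (d_defined \<Theta> M M' X est)" if "\<eta> > 0" for \<eta>
    by (rule whp_mono[OF main[OF that]]) simp
  then show "(\<lambda>n. measure (P n) {\<omega> \<in> space (P n). d_defined \<Theta> M M' X est n \<omega>}) \<longlonglongrightarrow> 1"
    by (intro whp_tendsto_1 prob meas(1))
  have "whp P \<eta> (\<lambda>n \<omega>. \<bar>Z n \<omega> + W n \<omega>\<bar> \<le> \<eta>)" if "\<eta> > 0" for \<eta>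
    by (rule whp_mono[OF main[OF that]]) simp
  moreover have "Z n \<in> borel_measurable (P n)" for n
    unfolding Z_def by (rule meas(2))
  ultimately have "weak_conv_m (\<lambda>n. distr (P n) borel (Z n)) std_normal_distribution"
    by (intro weak_conv_std_normal_reflect[OF clt W_meas _ prob])
  then show "weak_conv_m (\<lambda>n. distr (P n) borel (studentized_error \<Theta> M M' X est \<theta> n))
      std_normal_distribution"
    by (simp add: Z_def)
qed

end
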